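(* Let $D\subseteq[n]\times[m]$ be a \%-avoiding diagram with double orthodontic sequence $\mathbf K(D)=(K_1,\dots,K_n)$, $\mathbf i(D)=(i_1,\dots,i_\ell)$, $\mathbf j(D)=(j_1,\dots,j_\ell)$, $\mathbf M(D)=(M_1,\dots,M_\ell)$. Define $$\mathscr G_D(\mathbf x;\mathbf y):=\overline\omega_1^{K_1}\overline\omega_2^{K_2}\cdots\overline\omega_n^{K_n}\,\overline\pi_{i_1,j_1}\bigl(\overline\omega_{i_1}^{M_1}\,\overline\pi_{i_2,j_2}(\overline\omega_{i_2}^{M_2}\cdots\overline\pi_{i_\ell,j_\ell}(\overline\omega_{i_\ell}^{M_\ell})\cdots)\bigr).$$ When $D=D(w)\subseteq[n]\times[n]$ is the Rothe diagram of a permutation $w\in S_n$, then $\mathscr G_D(\mathbf x;\mathbf y)=\mathfrak G_w(\mathbf x;\mathbf y)$.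
   Context: Notation: $[n]=\{1,\dots,n\}$. Permutations act on the right: $ws_i$ is $w$ with the values $w(i),w(i+1)$ swapped; $\ell(w)$ is Coxeter length and $w_0$ is the longest element of $S_n$. Operators. On polynomials in $x_1,\dots,x_n$ and variables $y_j$ ($j\in\mathbb Z$), for $i\in[n-1]$ let $s_i$ swap $x_i,x_{i+1}$ and set $\partial_i(f)=\frac{f-s_if}{x_i-x_{i+1}}$, $\overline\partial_i(f)=\partial_i((1-x_{i+1})f)$, and $\overline\pi_{i,j}(f)=\overline\partial_i((x_i+y_j-x_iy_j)f)$. For $i\in[n]$ and a finite set $M$ of positive integers, $\overline\omega_i^M=\prod_{a\in[i],\,m\in M}(x_a+y_m-x_ay_m)$. Double Grothendieck polynomials. For $w\in S_n$, $\mathfrak G_w(\mathbf x;\mathbf y)$ is defined recursively by $\mathfrak G_{w_0}=\prod_{i+j\le n}(x_i+y_j-x_iy_j)$ and $\mathfrak G_w=\overline\partial_i\mathfrak G_{ws_i}$ if $\ell(w)<\ell(ws_i)$. Diagrams. A diagram is a subset $D\subseteq[n]\times[m]$, identified with its columns $(D_1,\dots,D_m)$, $D_j=\{i\in[n]:(i,j)\in D\}$. The Rothe diagram of $w\in S_n$ is $D(w)=\{(i,j)\in[n]\times[n]: i<w^{-1}(j),\ j<w(i)\}$; Rothe diagrams are \%-avoiding. $D$ is \%-avoiding if whenever $i_1<i_2$, $j_1<j_2$, $i_2\in D_{j_1}$ and $i_1\in D_{j_2}$, then $i_1\in D_{j_1}$ or $i_2\in D_{j_2}$. Double orthodontic sequence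 of a \%-avoiding diagram $D$. Set $K_i=\{j: D_j=[i]\}$ for $i\in[n]$, and let $D_-$ be $D$ with all these columns replaced by empty columns. A missing tooth of a column $C\subseteq[n]$ is $i\in[n-1]$ with $i\notin C$, $i+1\in C$. If the current diagram $E$ (initially $E=D_-$) is nonempty, perform the $k$-th orthodontic step ($k=1,2,\dots$): let $E_j$ be the leftmost nonempty column of $E$, let $i_k$ be its smallest missing tooth, and let $j_k=j-\#\{a\le i_k: a\notin E_j\}$ (which may be $\le 0$); swap rows $i_k$ and $i_k+1$ of $E$ to get $E'$; let $M_k=\{j:E'_j=[i_k]\}$; let $E''$ be $E'$ with the columns equal to $[i_k]$ replaced by empty columns, and continue with $E''$ as the current diagram. Stop when the diagram is empty (this always happens after finitely many steps); $\ell$ is the number of steps performed. If $\ell=0$, the formula for $\mathscr G_D$ is read as $\overline\omega_1^{K_1}\cdots\overline\omega_n^{K_n}$. *)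

theory Defs
  imports "HOL-Library.Poly_Mapping" "HOL-Combinatorics.Permutations"
begin

section \<open>Polynomials in the \<open>x\<close>- and \<open>y\<close>-variables\<close>

datatype var = X nat | Y int

text \<open>The order on variables only serves to obtain the library's instance of \<open>idom\<close> for
  polynomials.\<close>

instantiation var :: linorder
begin

fun less_eq_var :: "var \<Rightarrow> var \<Rightarrow> bool" where
  "less_eq_var (X i) (X j) \<longleftrightarrow> i \<le> j"
| "less_eq_var (X i) (Y j) \<longleftrightarrow> True"
| "less_eq_var (Y i) (X j) \<longleftrightarrow> False"
| "less_eq_var (Y i) (Y j) \<longleftrightarrow> i \<le> j"

definition less_var :: "var \<Rightarrow> var \<Rightarrow> bool" where
  "less_var u v \<longleftrightarrow> u \<le> v \<and> \<not> v \<le> u"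

instance
proof
  fix u v w :: var
  show "u < v \<longleftrightarrow> u \<le> v \<and> \<not> v \<le> u" by (rule less_var_def)
  show "u \<le> u" by (cases u) auto
  show "u \<le> v \<Longrightarrow> v \<le> w \<Longrightarrow> u \<le> w" by (cases u; cases v; cases w) auto
  show "u \<le> v \<Longrightarrow> v \<le> u \<Longrightarrow> u = v" by (cases u; cases v) auto
  show "u \<le> v \<or> v \<le> u" by (cases u; cases v) auto
qed

end

text \<open>A polynomial maps each monomial, an exponent vector \<open>var \<Rightarrow>\<^sub>0 nat\<close>, to its integer
  coefficient. The ring contains infinitely many \<open>x\<close>-variables; for given \<open>n\<close> only those with
  index in \<open>{1..n}\<close> are ever used below.\<close>

type_synonym polynomial = "(var \<Rightarrow>\<^sub>0 nat) \<Rightarrow>\<^sub>0 int"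

definition Var :: "var \<Rightarrow> polynomial" where
  "Var v = Poly_Mapping.single (Poly_Mapping.single v 1) 1"

abbreviation xv :: "nat \<Rightarrow> polynomial" where "xv i \<equiv> Var (X i)"
abbreviation yv :: "int \<Rightarrow> polynomial" where "yv j \<equiv> Var (Y j)"

definition oplus :: "polynomial \<Rightarrow> polynomial \<Rightarrow> polynomial" where
  "oplus f g = f + g - f * g"


section \<open>Operators\<close>

text \<open>\<open>swap_x i\<close> is the ring automorphism exchanging \<open>xv i\<close> and \<open>xv (Suc i)\<close>; see
  \<open>swap_x_mult\<close> and \<open>swap_x_Var\<close> below.\<close>

definition swap_x :: "nat \<Rightarrow> polynomial \<Rightarrow> polynomial" where
  "swap_x i f = Poly_Mapping.map_key (Poly_Mapping.map_key (transpose (X i) (X (Suc i)))) f"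

text \<open>The quotient is taken in the polynomial ring; it exists and is unique by
  \<open>ddiff_unique_exists\<close> below.\<close>

definition ddiff :: "nat \<Rightarrow> polynomial \<Rightarrow> polynomial" where
  "ddiff i f = (THE g. (xv i - xv (Suc i)) * g = f - swap_x i f)"

definition ddiff_bar :: "nat \<Rightarrow> polynomial \<Rightarrow> polynomial" where
  "ddiff_bar i f = ddiff i ((1 - xv (Suc i)) * f)"

definition pi_bar :: "nat \<Rightarrow> int \<Rightarrow> polynomial \<Rightarrow> polynomial" where
  "pi_bar i j f = ddiff_bar i (oplus (xv i) (yv j) * f)"

definition omega_bar :: "nat \<Rightarrow> nat set \<Rightarrow> polynomial" where
  "omega_bar i M = (\<Prod>a\<in>{1..i}. \<Prod>m\<in>M. oplus (xv a) (yv (int m)))"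

lemma inj_map_key_transpose:
  "inj (Poly_Mapping.map_key (transpose u v) :: (var \<Rightarrow>\<^sub>0 nat) \<Rightarrow> _)"
proof (rule inj_on_inverseI)
  fix m :: "var \<Rightarrow>\<^sub>0 nat"
  show "Poly_Mapping.map_key (transpose u v) (Poly_Mapping.map_key (transpose u v) m) = m"
    by (simp add: map_key_compose map_key_id id_def)
qed

lemma map_key_transpose_involutive:
  "Poly_Mapping.map_key (transpose u v) (Poly_Mapping.map_key (transpose u v) m) =
    (m :: var \<Rightarrow>\<^sub>0 nat)"
  by (simp add: map_key_compose map_key_id id_def)

lemma swap_x_add: "swap_x i (f + g) = swap_x i f + swap_x i g"
  by (simp add: swap_x_def map_key_plus inj_map_key_transpose)

lemma swap_x_single:
  "swap_x i (Poly_Mapping.single m c) =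
    Poly_Mapping.single (Poly_Mapping.map_key (transpose (X i) (X (Suc i))) m) c"
proof -
  let ?s = "Poly_Mapping.map_key (transpose (X i) (X (Suc i)))"
  have "swap_x i (Poly_Mapping.single (?s (?s m)) c) = Poly_Mapping.single (?s m) c"
    unfolding swap_x_def by (rule map_key_single[OF inj_map_key_transpose])
  then show ?thesis by (simp only: map_key_transpose_involutive)
qed

lemma swap_x_zero: "swap_x i 0 = 0"
  by (simp add: swap_x_def inj_map_key_transpose)

lemma swap_x_const: "swap_x i (Poly_Mapping.single 0 c) = Poly_Mapping.single 0 c"
  by (simp add: swap_x_single)

lemma swap_x_Var: "swap_x i (Var v) = Var (transpose (X i) (X (Suc i)) v)"
proof -
  let ?t = "transpose (X i) (X (Suc i))"
  have "Poly_Mapping.map_key ?t (Poly_Mapping.single (?t (?t v)) (1::nat)) =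
    Poly_Mapping.single (?t v) 1"
    by (rule map_key_single) simp
  then show ?thesis by (simp add: Var_def swap_x_single)
qed

lemma polynomial_induct [case_names zero single add]:
  fixes f :: polynomial
  assumes "P 0" "\<And>m c. P (Poly_Mapping.single m c)" "\<And>f g. P f \<Longrightarrow> P g \<Longrightarrow> P (f + g)"
  shows "P f"
proof (induction f rule: update_induct)
  case const
  show ?case by fact
next
  case (update f m c)
  have "Poly_Mapping.update m c f = f + Poly_Mapping.single m c"
    by (rule poly_mapping_eqI)
      (use update(1) in \<open>auto simp: lookup_update lookup_add lookup_single in_keys_iff when_def\<close>)
  with assms update show ?case by simp
qed

lemma swap_x_mult: "swap_x i (f * g) = swap_x i f * swap_x i g"
proof (induction f rule: polynomial_induct)
  case (single m c)
  show ?case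
    by (induction g rule: polynomial_induct)
      (simp_all add: swap_x_zero swap_x_single mult_single swap_x_add distrib_left map_key_plus)
qed (simp_all add: swap_x_zero swap_x_add distrib_right)

lemma swap_x_diff_dvd: "xv i - xv (Suc i) dvd f - swap_x i f"
proof -
  let ?d = "xv i - xv (Suc i)"
  have mult: "?d dvd f * g - swap_x i (f * g)"
    if "?d dvd f - swap_x i f" "?d dvd g - swap_x i g" for f g
  proof -
    have "f * g - swap_x i (f * g) =
        f * (g - swap_x i g) + (f - swap_x i f) * swap_x i g"
      by (simp add: swap_x_mult algebra_simps)
    with that show ?thesis by simp
  qed
  have var: "?d dvd Var v - swap_x i (Var v)" for v
  proof -
    have "?d dvd xv (Suc i) - xv i" by (metis dvd_minus_iff dvd_refl minus_diff_eq)
    then show ?thesis by (auto simp: swap_x_Var transpose_def)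
  qed
  have mon: "?d dvd Poly_Mapping.single m 1 - swap_x i (Poly_Mapping.single m 1)" for m
  proof (induction m rule: update_induct)
    case const
    show ?case by (simp add: swap_x_const[of _ 1, simplified])
  next
    case (update m v k)
    have eq: "Poly_Mapping.update v k m = m + Poly_Mapping.single v k"
      by (rule poly_mapping_eqI)
        (use update(1) in \<open>auto simp: lookup_update lookup_add lookup_single in_keys_iff when_def\<close>)
    have pow: "?d dvd Poly_Mapping.single (Poly_Mapping.single v k) 1 -
        swap_x i (Poly_Mapping.single (Poly_Mapping.single v k) 1)" for k
    proof (induction k)
      case 0
      show ?case by (simp add: swap_x_const[of _ 1, simplified])
    next
      case (Suc k)
      have "Poly_Mapping.single (Poly_Mapping.single v (Suc k)) 1 =
          Var v * Poly_Mapping.single (Poly_Mapping.single v k) (1::int)"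
        by (simp add: Var_def mult_single flip: single_add)
      then show ?case using mult[OF var Suc.IH] by simp
    qed
    have "Poly_Mapping.single (Poly_Mapping.update v k m) 1 =
        Poly_Mapping.single m 1 * Poly_Mapping.single (Poly_Mapping.single v k) (1::int)"
      by (simp add: eq mult_single)
    then show ?case using mult[OF update.IH pow] by simp
  qed
  show ?thesis
  proof (induction f rule: polynomial_induct)
    case zero
    show ?case by (simp add: swap_x_zero)
  next
    case (single m c)
    have "Poly_Mapping.single m c = Poly_Mapping.single 0 c * Poly_Mapping.single m 1"
      by (simp add: mult_single)
    moreover have "?d dvd Poly_Mapping.single 0 c - swap_x i (Poly_Mapping.single 0 c)"
      by (simp only: swap_x_const diff_self dvd_0_right)
    ultimately show ?case using mult[OF _ mon] by metis
  next
    case (add f g)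
    then have "?d dvd (f - swap_x i f) + (g - swap_x i g)" by (rule dvd_add)
    then show ?case by (simp add: swap_x_add algebra_simps)
  qed
qed

lemma x_diff_nonzero: "xv i - xv (Suc i) \<noteq> 0"
proof
  assume "xv i - xv (Suc i) = 0"
  then have "Poly_Mapping.lookup (xv i) (Poly_Mapping.single (X i) 1) =
      Poly_Mapping.lookup (xv (Suc i)) (Poly_Mapping.single (X i) 1)"
    by simp
  moreover have "Poly_Mapping.single (X (Suc i)) 1 \<noteq> Poly_Mapping.single (X i) (1::nat)"
    by (metis lookup_single_eq lookup_single_not_eq n_not_Suc_n var.inject(1) zero_neq_one)
  ultimately show False by (simp add: Var_def lookup_single_not_eq)
qed

lemma ddiff_unique_exists: "\<exists>!g. (xv i - xv (Suc i)) * g = f - swap_x i f"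
proof (rule ex_ex1I)
  show "\<exists>g. (xv i - xv (Suc i)) * g = f - swap_x i f"
    using swap_x_diff_dvd[of i f] by (metis dvdE)
  show "g = h" if "(xv i - xv (Suc i)) * g = f - swap_x i f"
    "(xv i - xv (Suc i)) * h = f - swap_x i f" for g h
    using that x_diff_nonzero[of i] by (metis mult_left_cancel)
qed


section \<open>Double Grothendieck polynomials\<close>

text \<open>A permutation \<open>w \<in> S\<^sub>n\<close> is a function with \<open>w permutes {1..n}\<close>. Since permutations act on
  the right, \<open>w s\<^sub>i\<close> is \<open>w \<circ> simple_refl i\<close>.\<close>

definition simple_refl :: "nat \<Rightarrow> nat \<Rightarrow> nat" where
  "simple_refl i = transpose i (Suc i)"

definition coxeter_length :: "nat \<Rightarrow> (nat \<Rightarrow> nat) \<Rightarrow> nat" where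
  "coxeter_length n w =
    (LEAST k. \<exists>is. length is = k \<and> set is \<subseteq> {1..<n} \<and>
      w = foldr (\<lambda>i v. simple_refl i \<circ> v) is id)"

definition longest_perm :: "nat \<Rightarrow> nat \<Rightarrow> nat" where
  "longest_perm n = (THE w. w permutes {1..n} \<and>
    (\<forall>v. v permutes {1..n} \<longrightarrow> coxeter_length n v \<le> coxeter_length n w))"

text \<open>\<open>is_double_grothendieck n w f\<close> states that \<open>f\<close> is obtained for \<open>w\<close> by some run of the
  recursion, which leaves the choice of the ascent \<open>i\<close> open; the double Grothendieck
  polynomial is the polynomial that all runs yield.\<close>

inductive is_double_grothendieck :: "nat \<Rightarrow> (nat \<Rightarrow> nat) \<Rightarrow> polynomial \<Rightarrow> bool" for n where
  longest: "is_double_grothendieck n (longest_perm n)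
    (\<Prod>(i, j) \<in> {(i, j). 1 \<le> i \<and> 1 \<le> j \<and> i + j \<le> n}. oplus (xv i) (yv (int j)))"
| ascent: "w permutes {1..n} \<Longrightarrow> i \<in> {1..<n} \<Longrightarrow>
    coxeter_length n w < coxeter_length n (w \<circ> simple_refl i) \<Longrightarrow>
    is_double_grothendieck n (w \<circ> simple_refl i) f \<Longrightarrow>
    is_double_grothendieck n w (ddiff_bar i f)"

definition double_grothendieck :: "nat \<Rightarrow> (nat \<Rightarrow> nat) \<Rightarrow> polynomial" where
  "double_grothendieck n w = (THE f. is_double_grothendieck n w f)"


section \<open>Diagrams\<close>

type_synonym diagram = "(nat \<times> nat) set"

definition column :: "diagram \<Rightarrow> nat \<Rightarrow> nat set" where
  "column D j = {i. (i, j) \<in> D}"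

definition percent_avoiding :: "diagram \<Rightarrow> bool" where
  "percent_avoiding D \<longleftrightarrow> (\<forall>i1 i2 j1 j2. i1 < i2 \<and> j1 < j2 \<and>
    i2 \<in> column D j1 \<and> i1 \<in> column D j2 \<longrightarrow> i1 \<in> column D j1 \<or> i2 \<in> column D j2)"

definition rothe_diagram :: "nat \<Rightarrow> (nat \<Rightarrow> nat) \<Rightarrow> diagram" where
  "rothe_diagram n w = {(i, j) \<in> {1..n} \<times> {1..n}. i < inv w j \<and> j < w i}"

lemma percent_avoiding_rothe_diagram: "percent_avoiding (rothe_diagram n w)"
  unfolding percent_avoiding_def rothe_diagram_def column_def by force


section \<open>The double orthodontic sequence\<close>

text \<open>Intended for \<open>percent_avoiding\<close> diagrams \<open>D \<subseteq> {1..n} \<times> {1..m}\<close>. The number \<open>m\<close> of columns is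
  not a parameter: for \<open>i \<ge> 1\<close> a column equal to \<open>{1..i}\<close> is nonempty, so its index is at
  most \<open>m\<close>.\<close>

definition remove_columns :: "nat set \<Rightarrow> diagram \<Rightarrow> diagram" where
  "remove_columns J D = {(i, j) \<in> D. j \<notin> J}"

definition ortho_K :: "diagram \<Rightarrow> nat \<Rightarrow> nat set" where
  "ortho_K D i = {j. column D j = {1..i}}"

definition initial_diagram :: "nat \<Rightarrow> diagram \<Rightarrow> diagram" where
  "initial_diagram n D = remove_columns (\<Union>i\<in>{1..n}. ortho_K D i) D"

definition missing_tooth :: "nat \<Rightarrow> nat set \<Rightarrow> nat \<Rightarrow> bool" where
  "missing_tooth n C i \<longleftrightarrow> i \<in> {1..<n} \<and> i \<notin> C \<and> Suc i \<in> C"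

definition leftmost_column :: "diagram \<Rightarrow> nat" where
  "leftmost_column E = (LEAST j. column E j \<noteq> {})"

definition step_row :: "nat \<Rightarrow> diagram \<Rightarrow> nat" where
  "step_row n E = (LEAST i. missing_tooth n (column E (leftmost_column E)) i)"

definition step_index :: "nat \<Rightarrow> diagram \<Rightarrow> int" where
  "step_index n E = int (leftmost_column E) -
    int (card {a \<in> {1..step_row n E}. a \<notin> column E (leftmost_column E)})"

definition swap_rows :: "nat \<Rightarrow> diagram \<Rightarrow> diagram" where
  "swap_rows i E = (\<lambda>(a, j). (simple_refl i a, j)) ` E"

definition step_columns :: "nat \<Rightarrow> diagram \<Rightarrow> nat set" where
  "step_columns n E = {j. column (swap_rows (step_row n E) E) j = {1..step_row n E}}"

definition ortho_step :: "nat \<Rightarrow> diagram \<Rightarrow> diagram" where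
  "ortho_step n E = remove_columns (step_columns n E) (swap_rows (step_row n E) E)"

text \<open>\<open>ortho_diagram n D k\<close> is the current diagram after \<open>k\<close> steps, so that the \<open>k\<close>-th step acts on
  \<open>ortho_diagram n D (k - 1)\<close>.\<close>

definition ortho_diagram :: "nat \<Rightarrow> diagram \<Rightarrow> nat \<Rightarrow> diagram" where
  "ortho_diagram n D k = (ortho_step n ^^ k) (initial_diagram n D)"

definition ortho_length :: "nat \<Rightarrow> diagram \<Rightarrow> nat" where
  "ortho_length n D = (LEAST k. ortho_diagram n D k = {})"

definition ortho_i :: "nat \<Rightarrow> diagram \<Rightarrow> nat \<Rightarrow> nat" where
  "ortho_i n D k = step_row n (ortho_diagram n D (k - 1))"

definition ortho_j :: "nat \<Rightarrow> diagram \<Rightarrow> nat \<Rightarrow> int" where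
  "ortho_j n D k = step_index n (ortho_diagram n D (k - 1))"

definition ortho_M :: "nat \<Rightarrow> diagram \<Rightarrow> nat \<Rightarrow> nat set" where
  "ortho_M n D k = step_columns n (ortho_diagram n D (k - 1))"

definition ortho_polynomial :: "nat \<Rightarrow> diagram \<Rightarrow> polynomial" where
  "ortho_polynomial n D =
    (\<Prod>i\<in>{1..n}. omega_bar i (ortho_K D i)) *
    foldr (\<lambda>k f. pi_bar (ortho_i n D k) (ortho_j n D k)
        (omega_bar (ortho_i n D k) (ortho_M n D k) * f))
      [1..<Suc (ortho_length n D)] 1"

end

theory Submission
  imports Defs
begin

text \<open>Both polynomials satisfy a recursion, and the point is to make the two recursions meet.

  For a permutation \<open>w\<close> call a column of its Rothe diagram initial if it is \<open>{1..k}\<close> for some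
  \<open>k\<close>. The initial columns contribute the product \<open>initial_product\<close> in front, and the others form the
  current diagram \<open>E\<close> at the start of the orthodontic sequence. The claim is that the double
  Grothendieck polynomial of \<open>w\<close> is the initial product times a polynomial that the sequence
  computes from \<open>E\<close> alone (\<open>ortho_value_rothe_diagram\<close>). It is proved by induction on the sum of the
  row indices of the boxes of \<open>E\<close>.

  If \<open>E\<close> is empty, then \<open>w\<close> is dominant, and its Grothendieck polynomial is the product over its
  boxes (\<open>double_grothendieck_dominant\<close>). Otherwise let \<open>j\<close> be the first column that is not initial;
  let \<open>{1..q}\<close> be the rows it starts with, and let \<open>q + 1, \<dots>, q + m\<close> be its first gap. In the gap \<open>w\<close>
  takes the values \<open>j - m, \<dots>, j - 1\<close> in some order, and \<open>w (q + m + 1) > j\<close>. The next \<open>m\<close> steps of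
  the sequence move row \<open>q + m + 1\<close> up through the gap, which is empty in all columns of \<open>E\<close>. On the
  side of permutations, this is the passage to the permutation \<open>w'\<close> in which the large value has
  been moved to position \<open>q + 1\<close>; it consists of \<open>m\<close> ascents, so that the Grothendieck polynomial of
  \<open>w\<close> results from that of \<open>w'\<close> by a chain of \<open>m\<close> operators \<open>ddiff_bar\<close>. The current diagram of
  \<open>w'\<close> is the one reached by the sequence. The initial columns of \<open>w\<close> with index in
  \<open>j - m, \<dots>, j - 1\<close> are each one box higher in \<open>w'\<close>, and these additional boxes are exactly what
  turns the operators \<open>ddiff_bar\<close> into the operators \<open>pi_bar\<close> of the sequence
  (\<open>dbars_column_factors\<close>).

  The latter identity holds only for arguments that are symmetric in the variables
  \<open>x\<^sub>q\<^sub>+\<^sub>2, \<dots>, x\<^sub>q\<^sub>+\<^sub>m\<^sub>+\<^sub>1\<close>. The symmetry is obtained from a third permutation, namely \<open>w'\<close>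
  with the values \<open>j - m, \<dots>, j - 1\<close> sorted: it has the same current diagram, and its Grothendieck
  polynomial is symmetric in these variables because of its ascents.

  The definition of Grothendieck polynomials leaves open which ascents are used. That all choices
  give the same result follows from the commutation and braid relations of \<open>ddiff_bar\<close> by the
  diamond lemma (\<open>is_double_grothendieck_unique\<close>).\<close>


section \<open>Divided differences\<close>

lemma swap_x_uminus: "swap_x i (- f) = - swap_x i f"
proof -
  have "swap_x i (- f) + swap_x i f = 0"
    by (simp add: swap_x_zero flip: swap_x_add)
  then show ?thesis by (simp add: eq_neg_iff_add_eq_0)
qed

lemma swap_x_diff: "swap_x i (f - g) = swap_x i f - swap_x i g"
  using swap_x_add[of i f "- g"] by (simp add: swap_x_uminus)

lemma swap_x_one: "swap_x i 1 = 1"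
  using swap_x_const[of i 1] by simp

lemmas swap_x_hom = swap_x_add swap_x_mult swap_x_diff swap_x_uminus swap_x_one swap_x_zero

lemma swap_x_prod: "swap_x i (\<Prod>a\<in>A. f a) = (\<Prod>a\<in>A. swap_x i (f a))"
  by (induction A rule: infinite_finite_induct) (simp_all add: swap_x_hom)

lemma swap_x_xv: "swap_x i (xv a) = xv (simple_refl i a)"
  by (auto simp: swap_x_Var simple_refl_def transpose_def)

lemma swap_x_yv [simp]: "swap_x i (yv c) = yv c"
  by (simp add: swap_x_Var transpose_def)

lemma swap_x_oplus: "swap_x i (oplus (xv a) (yv c)) = oplus (xv (simple_refl i a)) (yv c)"
  by (simp add: oplus_def swap_x_hom swap_x_xv)

lemma swap_x_xv_simps [simp]:
  "swap_x i (xv i) = xv (Suc i)" "swap_x i (xv (Suc i)) = xv i"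
  "a \<noteq> i \<Longrightarrow> a \<noteq> Suc i \<Longrightarrow> swap_x i (xv a) = xv a"
  by (simp_all add: swap_x_xv simple_refl_def)

lemma map_key_transpose_compose:
  fixes m :: "var \<Rightarrow>\<^sub>0 nat"
  shows "Poly_Mapping.map_key (transpose u v) (Poly_Mapping.map_key (transpose u' v') m) =
    Poly_Mapping.map_key (transpose u' v' \<circ> transpose u v) m"
  by (rule map_key_compose) simp_all

lemma swap_x_involutive [simp]: "swap_x i (swap_x i f) = f"
  by (induction f rule: polynomial_induct)
    (simp_all add: swap_x_hom swap_x_single map_key_transpose_involutive)

lemma swap_x_commute:
  assumes "Suc i < k"
  shows "swap_x i (swap_x k f) = swap_x k (swap_x i f)"
proof -
  have "transpose (X i) (X (Suc i)) \<circ> transpose (X k) (X (Suc k)) =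
      transpose (X k) (X (Suc k)) \<circ> transpose (X i) (X (Suc i))"
    using assms by (auto simp: fun_eq_iff transpose_def)
  then show ?thesis
    by (induction f rule: polynomial_induct)
      (simp_all add: swap_x_hom swap_x_single map_key_transpose_compose)
qed

lemma swap_x_braid:
  "swap_x i (swap_x (Suc i) (swap_x i f)) = swap_x (Suc i) (swap_x i (swap_x (Suc i) f))"
proof -
  have "Poly_Mapping.map_key (transpose (X i) (X (Suc i)))
        (Poly_Mapping.map_key (transpose (X (Suc i)) (X (Suc (Suc i))))
          (Poly_Mapping.map_key (transpose (X i) (X (Suc i))) m)) =
      Poly_Mapping.map_key (transpose (X (Suc i)) (X (Suc (Suc i))))
        (Poly_Mapping.map_key (transpose (X i) (X (Suc i)))
          (Poly_Mapping.map_key (transpose (X (Suc i)) (X (Suc (Suc i)))) m))"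
    for m :: "var \<Rightarrow>\<^sub>0 nat"
    by (simp add: map_key_compose inj_compose)
      (rule arg_cong[where f = "\<lambda>t. Poly_Mapping.map_key t m"], auto simp: fun_eq_iff transpose_def)
  then show ?thesis
    by (induction f rule: polynomial_induct) (simp_all add: swap_x_hom swap_x_single)
qed

lemma ddiff_eq: "(xv i - xv (Suc i)) * ddiff i f = f - swap_x i f"
  unfolding ddiff_def by (rule theI'[OF ddiff_unique_exists])

lemma ddiffI: "(xv i - xv (Suc i)) * g = f - swap_x i f \<Longrightarrow> ddiff i f = g"
  using ddiff_eq[of i f] x_diff_nonzero[of i] by (metis mult_left_cancel)

lemma swap_x_ddiff [simp]: "swap_x i (ddiff i f) = ddiff i f"
proof (rule ddiffI[symmetric])
  have "swap_x i ((xv i - xv (Suc i)) * ddiff i f) = swap_x i (f - swap_x i f)"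
    by (simp only: ddiff_eq)
  then show "(xv i - xv (Suc i)) * swap_x i (ddiff i f) = f - swap_x i f"
    by (simp add: swap_x_hom algebra_simps)
qed

lemma ddiff_add: "ddiff i (f + g) = ddiff i f + ddiff i g"
  by (rule ddiffI) (simp add: distrib_left ddiff_eq swap_x_hom)

lemma ddiff_sym_eq_0: "swap_x i f = f \<Longrightarrow> ddiff i f = 0"
  by (rule ddiffI) simp

lemma ddiff_mult: "ddiff i (f * g) = ddiff i f * g + swap_x i f * ddiff i g"
proof (rule ddiffI)
  have "(xv i - xv (Suc i)) * (ddiff i f * g + swap_x i f * ddiff i g) =
      ((xv i - xv (Suc i)) * ddiff i f) * g + swap_x i f * ((xv i - xv (Suc i)) * ddiff i g)"
    by (simp add: algebra_simps)
  also have "\<dots> = f * g - swap_x i (f * g)"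
    unfolding ddiff_eq by (simp add: swap_x_hom algebra_simps)
  finally show "(xv i - xv (Suc i)) * (ddiff i f * g + swap_x i f * ddiff i g) =
      f * g - swap_x i (f * g)" .
qed

lemma ddiff_mult_sym: "swap_x i f = f \<Longrightarrow> ddiff i (f * g) = f * ddiff i g"
  by (simp add: ddiff_mult ddiff_sym_eq_0)

lemma ddiff_one_minus: "ddiff i (1 - xv (Suc i)) = 1"
  by (rule ddiffI) (simp add: swap_x_hom)

lemma swap_x_ddiff_far:
  assumes "Suc i < k \<or> Suc k < i"
  shows "swap_x k (ddiff i f) = ddiff i (swap_x k f)"
proof (rule ddiffI[symmetric])
  have "swap_x k ((xv i - xv (Suc i)) * ddiff i f) = swap_x k (f - swap_x i f)"
    by (simp only: ddiff_eq)
  then show "(xv i - xv (Suc i)) * swap_x k (ddiff i f) = swap_x k f - swap_x i (swap_x k f)"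
    using assms swap_x_commute[of i k f] swap_x_commute[of k i f] by (auto simp: swap_x_hom)
qed

lemma ddiff_commute:
  assumes "Suc i < k"
  shows "ddiff i (ddiff k f) = ddiff k (ddiff i f)"
proof (rule ddiffI)
  have "(xv i - xv (Suc i)) * ddiff k (ddiff i f) = ddiff k ((xv i - xv (Suc i)) * ddiff i f)"
    using assms by (intro ddiff_mult_sym[symmetric]) (simp add: swap_x_hom)
  also have "\<dots> = ddiff k (f - swap_x i f)" by (simp only: ddiff_eq)
  also have "\<dots> = ddiff k f - ddiff k (swap_x i f)"
    by (metis add_diff_cancel_right' ddiff_add diff_add_cancel)
  finally show "(xv i - xv (Suc i)) * ddiff k (ddiff i f) = ddiff k f - swap_x i (ddiff k f)"
    using assms by (simp add: swap_x_ddiff_far)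
qed

text \<open>The braid relation is checked after multiplication by the Vandermonde product of the three
  variables, where both sides become the alternating sum of \<open>f\<close> over the symmetric group \<open>S\<^sub>3\<close>.\<close>

lemma ddiff_braid: "ddiff i (ddiff (Suc i) (ddiff i f)) = ddiff (Suc i) (ddiff i (ddiff (Suc i) f))"
proof -
  define a b c where "a = xv i" and "b = xv (Suc i)" and "c = xv (Suc (Suc i))"
  let ?s = "swap_x i" and ?t = "swap_x (Suc i)"
  have abc: "?s a = b" "?s b = a" "?s c = c" "?t a = a" "?t b = c" "?t c = b"
    by (simp_all add: a_def b_def c_def)
  have D: "(a - b) * ddiff i g = g - ?s g" "(b - c) * ddiff (Suc i) g = g - ?t g" for g
    unfolding a_def b_def c_def by (rule ddiff_eq)+
  have st: "(a - c) * ?s (ddiff (Suc i) g) = ?s g - ?s (?t g)" for g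
    using arg_cong[OF D(2)[of g], of ?s] by (simp add: swap_x_hom abc)
  have ts: "(a - c) * ?t (ddiff i g) = ?t g - ?t (?s g)" for g
    using arg_cong[OF D(1)[of g], of ?t] by (simp add: swap_x_hom abc)
  have sts: "(b - c) * ?s (?t (ddiff i g)) = ?s (?t g) - ?s (?t (?s g))" for g
    using arg_cong[OF ts[of g], of ?s] by (simp add: swap_x_hom abc)
  have tst: "(a - b) * ?t (?s (ddiff (Suc i) g)) = ?t (?s g) - ?t (?s (?t g))" for g
    using arg_cong[OF st[of g], of ?t] by (simp add: swap_x_hom abc)
  define \<Delta> where "\<Delta> = (a - b) * (b - c) * (a - c)"
  have "\<Delta> \<noteq> 0"
  proof -
    have "a - c \<noteq> 0"
    proof
      assume "a - c = 0"
      then have "?t (a - c) = 0" by (simp add: swap_x_zero)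
      then show False
        using x_diff_nonzero[of i] by (simp add: swap_x_hom abc) (simp add: a_def b_def)
    qed
    then show ?thesis
      using x_diff_nonzero[of i] x_diff_nonzero[of "Suc i"] by (simp add: \<Delta>_def a_def b_def c_def)
  qed
  \<comment> \<open>The identities \<open>st\<close>, \<open>ts\<close>, \<open>sts\<close>, \<open>tst\<close> carry the defining equations \<open>D\<close> along the swaps, so
     that every denominator in the iterated quotient is cleared by one factor of \<open>\<Delta>\<close>.\<close>
  have "\<Delta> * ddiff i (ddiff (Suc i) (ddiff i f)) =
      f - ?s f - ?t f + ?t (?s f) + ?s (?t f) - ?s (?t (?s f))"
  proof -
    define h where "h = ddiff i f"
    define g where "g = ddiff (Suc i) h"
    have "\<Delta> * ddiff i g = (b - c) * (a - c) * ((a - b) * ddiff i g)" 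
      by (simp add: \<Delta>_def mult_ac)
    also have "\<dots> = (a - c) * ((b - c) * g) - (b - c) * ((a - c) * ?s g)"
      unfolding D(1) by (simp add: algebra_simps)
    also have "\<dots> = (a - c) * (h - ?t h) - (b - c) * (?s h - ?s (?t h))"
      unfolding g_def D(2) st ..
    also have "?s h = h" by (simp add: h_def)
    also have "(a - c) * (h - ?t h) - (b - c) * (h - ?s (?t h)) =
        (a - b) * h - (a - c) * ?t h + (b - c) * ?s (?t h)"
      by (simp add: algebra_simps)
    also have "\<dots> = f - ?s f - (?t f - ?t (?s f)) + (?s (?t f) - ?s (?t (?s f)))"
      unfolding h_def D ts sts ..
    finally show ?thesis by (simp add: g_def h_def)
  qed
  moreover have "\<Delta> * ddiff (Suc i) (ddiff i (ddiff (Suc i) f)) =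
      f - ?s f - ?t f + ?t (?s f) + ?s (?t f) - ?t (?s (?t f))"
  proof -
    define h where "h = ddiff (Suc i) f"
    define g where "g = ddiff i h"
    have "\<Delta> * ddiff (Suc i) g = (a - b) * (a - c) * ((b - c) * ddiff (Suc i) g)" 
      by (simp add: \<Delta>_def mult_ac)
    also have "\<dots> = (a - c) * ((a - b) * g) - (a - b) * ((a - c) * ?t g)"
      unfolding D(2) by (simp add: algebra_simps)
    also have "\<dots> = (a - c) * (h - ?s h) - (a - b) * (?t h - ?t (?s h))"
      unfolding g_def D(1) ts ..
    also have "?t h = h" by (simp add: h_def)
    also have "(a - c) * (h - ?s h) - (a - b) * (h - ?t (?s h)) =
        (b - c) * h - (a - c) * ?s h + (a - b) * ?t (?s h)"
      by (simp add: algebra_simps)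
    also have "\<dots> = f - ?t f - (?s f - ?s (?t f)) + (?t (?s f) - ?t (?s (?t f)))"
      unfolding h_def D st tst ..
    finally show ?thesis by (simp add: g_def h_def)
  qed
  ultimately show ?thesis
    using \<open>\<Delta> \<noteq> 0\<close> by (metis mult_left_cancel swap_x_braid)
qed

lemma swap_x_ddiff_bar [simp]: "swap_x i (ddiff_bar i f) = ddiff_bar i f"
  by (simp add: ddiff_bar_def)

lemma ddiff_bar_mult_sym: "swap_x i f = f \<Longrightarrow> ddiff_bar i (f * g) = f * ddiff_bar i g"
  by (simp add: ddiff_bar_def ddiff_mult_sym mult.left_commute[of _ f])

lemma swap_x_ddiff_bar_far:
  assumes "Suc i < k \<or> Suc k < i"
  shows "swap_x k (ddiff_bar i f) = ddiff_bar i (swap_x k f)"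
proof -
  have "k \<noteq> Suc i" "Suc k \<noteq> Suc i" using assms by auto
  then show ?thesis
    unfolding ddiff_bar_def swap_x_ddiff_far[OF assms] by (simp add: swap_x_hom)
qed

lemma ddiff_bar_commute:
  assumes "Suc i < k"
  shows "ddiff_bar i (ddiff_bar k f) = ddiff_bar k (ddiff_bar i f)"
proof -
  have "ddiff_bar i (ddiff_bar k f) = ddiff i (ddiff k ((1 - xv (Suc i)) * ((1 - xv (Suc k)) * f)))"
    unfolding ddiff_bar_def using assms by (subst ddiff_mult_sym) (simp_all add: swap_x_hom)
  moreover have "ddiff_bar k (ddiff_bar i f) =
      ddiff k (ddiff i ((1 - xv (Suc k)) * ((1 - xv (Suc i)) * f)))"
    unfolding ddiff_bar_def using assms by (subst (2) ddiff_mult_sym) (simp_all add: swap_x_hom)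
  ultimately show ?thesis
    by (simp add: ddiff_commute[OF assms] mult.left_commute)
qed

text \<open>With \<open>b = 1 - x\<^sub>i\<^sub>+\<^sub>1\<close> and \<open>c = 1 - x\<^sub>i\<^sub>+\<^sub>2\<close>, both sides equal the longest divided difference in
  three variables applied to \<open>b c\<^sup>2 f\<close>; thus the relation reduces to the one without bars.\<close>

lemma ddiff_bar_braid:
  "ddiff_bar i (ddiff_bar (Suc i) (ddiff_bar i f)) =
    ddiff_bar (Suc i) (ddiff_bar i (ddiff_bar (Suc i) f))"
proof -
  define b c where "b = 1 - xv (Suc i)" and "c = 1 - xv (Suc (Suc i))"
  have c: "swap_x i c = c" and tc: "swap_x (Suc i) c = b" and dc: "ddiff (Suc i) c = 1"
    by (simp_all add: b_def c_def swap_x_hom ddiff_one_minus)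
  have "swap_x (Suc i) (b * c) = b * c"
    by (simp add: b_def c_def swap_x_hom mult.commute)
  then have bc: "ddiff (Suc i) (b * (c * g)) = b * (c * ddiff (Suc i) g)" for g
    using ddiff_mult_sym[of "Suc i" "b * c" g] by (simp add: mult.assoc)
  have "ddiff_bar i (ddiff_bar (Suc i) (ddiff_bar i f)) =
      ddiff i (b * ddiff (Suc i) (c * ddiff i (b * f)))"
    by (simp add: ddiff_bar_def b_def c_def)
  also have "\<dots> = ddiff i (b * ddiff (Suc i) (ddiff i (c * (b * f))))"
    by (simp add: ddiff_mult_sym[OF c])
  \<comment> \<open>Replacing the factor \<open>b\<close> outside by \<open>c\<close> inside changes the argument of the outer operator by
     the value of \<open>ddiff i\<close> alone, which is symmetric and hence killed.\<close>
  also have "\<dots> = ddiff i (ddiff (Suc i) (c * ddiff i (c * (b * f))))"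
  proof -
    let ?g = "ddiff i (c * (b * f))"
    have "ddiff i (ddiff (Suc i) (c * ?g)) = ddiff i ?g + ddiff i (b * ddiff (Suc i) ?g)"
      by (simp add: ddiff_mult[of "Suc i"] dc tc ddiff_add)
    then show ?thesis by (simp add: ddiff_sym_eq_0)
  qed
  also have "\<dots> = ddiff i (ddiff (Suc i) (ddiff i (c * (c * (b * f)))))"
    by (simp add: ddiff_mult_sym[OF c])
  also have "\<dots> = ddiff (Suc i) (ddiff i (ddiff (Suc i) (b * (c * (c * f)))))"
    by (simp add: ddiff_braid mult_ac)
  also have "\<dots> = ddiff (Suc i) (ddiff i (c * (b * ddiff (Suc i) (c * f))))"
    by (simp add: bc mult.left_commute)
  also have "\<dots> = ddiff (Suc i) (c * ddiff i (b * ddiff (Suc i) (c * f)))"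
    by (simp add: ddiff_mult_sym[OF c])
  finally show ?thesis by (simp add: ddiff_bar_def b_def c_def)
qed

text \<open>Since \<open>1 - oplus x y = (1 - x) (1 - y)\<close>, the argument of \<open>ddiff i\<close> is \<open>1 - xv (Suc i)\<close> up to a
  symmetric term.\<close>

lemma ddiff_bar_oplus: "ddiff_bar i (oplus (xv i) (yv c)) = 1"
proof -
  let ?p = "(1 - xv i) * (1 - xv (Suc i)) * (yv c - 1)"
  have "swap_x i ?p = ?p" by (simp add: swap_x_hom mult.commute)
  moreover have "(1 - xv (Suc i)) * oplus (xv i) (yv c) = (1 - xv (Suc i)) + ?p"
    by (simp add: oplus_def algebra_simps)
  ultimately show ?thesis
    by (simp add: ddiff_bar_def ddiff_add ddiff_one_minus ddiff_sym_eq_0)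
qed

text \<open>The Leibniz rule: the linear factor moves on to the next variable, at the price of a
  correction term that contains \<open>1 - xv (Suc i)\<close>. This factor is what makes the next operator in a
  chain annihilate the correction.\<close>

lemma ddiff_bar_oplus_mult:
  "ddiff_bar i (oplus (xv i) (yv c) * f) =
    oplus (xv (Suc i)) (yv c) * ddiff_bar i f + (1 - yv c) * (1 - xv (Suc i)) * f"
proof -
  have "ddiff i (oplus (xv i) (yv c)) = 1 - yv c"
    by (rule ddiffI) (simp add: oplus_def swap_x_hom algebra_simps)
  moreover have "swap_x i (oplus (xv i) (yv c)) = oplus (xv (Suc i)) (yv c)"
    by (simp add: oplus_def swap_x_hom)
  ultimately show ?thesis
    using ddiff_mult[of i "oplus (xv i) (yv c)" "(1 - xv (Suc i)) * f"]
    by (simp add: ddiff_bar_def mult_ac)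
qed


section \<open>Chains of operators\<close>

text \<open>The operator \<open>dbars q m\<close> applies \<open>ddiff_bar\<close> with indices \<open>q + 1, \<dots>, q + m\<close> in this order, and
  \<open>pibars q m j\<close> applies \<open>pi_bar\<close> with the same indices, paired with the \<open>y\<close>-indices
  \<open>j - 1, \<dots>, j - m\<close>. The second one is what the orthodontic sequence produces while it fills one
  gap \<open>q + 1, \<dots>, q + m\<close> of the column \<open>j\<close>.\<close>

primrec dbars :: "nat \<Rightarrow> nat \<Rightarrow> polynomial \<Rightarrow> polynomial" where
  "dbars q 0 f = f"
| "dbars q (Suc m) f = ddiff_bar (Suc (q + m)) (dbars q m f)"

primrec pibars :: "nat \<Rightarrow> nat \<Rightarrow> nat \<Rightarrow> polynomial \<Rightarrow> polynomial" where
  "pibars q 0 j f = f"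
| "pibars q (Suc m) j f = pi_bar (Suc (q + m)) (int j - int (Suc m)) (pibars q m j f)"

text \<open>The contribution of a column \<open>c\<close> that equals \<open>{1..k}\<close>.\<close>

definition column_factor :: "nat \<Rightarrow> nat \<Rightarrow> polynomial" where
  "column_factor k c = (\<Prod>b\<in>{1..k}. oplus (xv b) (yv (int c)))"

lemma swap_x_column_factor:
  assumes "i \<noteq> k" "1 \<le> i"
  shows "swap_x i (column_factor k c) = column_factor k c"
proof -
  have "bij_betw (simple_refl i) {1..k} {1..k}"
    by (rule bij_betwI[of _ _ _ "simple_refl i"])
      (use assms in \<open>auto simp: simple_refl_def transpose_def\<close>)
  then show ?thesis
    unfolding column_factor_def
    by (simp add: swap_x_prod swap_x_oplus prod.reindex_bij_betw[of _ _ _ "\<lambda>a. oplus (xv a) _"])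
qed

lemma column_factor_Suc:
  "column_factor (Suc k) c = column_factor k c * oplus (xv (Suc k)) (yv (int c))"
  by (simp add: column_factor_def prod.cl_ivl_Suc)

lemma dbars_mult_sym:
  assumes "\<And>i. i \<in> {Suc q..q + m} \<Longrightarrow> swap_x i f = f"
  shows "dbars q m (f * g) = f * dbars q m g"
  using assms by (induction m) (simp_all add: ddiff_bar_mult_sym)

lemma swap_x_dbars_far:
  assumes "Suc (q + m) < i"
  shows "swap_x i (dbars q m f) = dbars q m (swap_x i f)"
  using assms by (induction m) (simp_all add: swap_x_ddiff_bar_far)

text \<open>A column of height \<open>q + d + 1\<close> passes through the chain. The operators with smaller index
  commute with its factor, since this is symmetric in their variables. The operator with index
  \<open>q + d + 1\<close> splits off the last box, and each later operator moves that box one row down by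
  \<open>ddiff_bar_oplus_mult\<close>; the correction terms vanish because the argument is symmetric in the
  variables still to come. In the end the box sits directly in front of the last operator, which
  it turns into \<open>pi_bar\<close>.\<close>

lemma dbars_column_factor:
  assumes "\<And>i. i \<in> {q + d + 2..Suc (q + d + e)} \<Longrightarrow> swap_x i g = g"
  shows "dbars q (Suc (d + e)) (column_factor (Suc (q + d)) c * g) =
    column_factor (q + d) c *
      ddiff_bar (Suc (q + d + e)) (oplus (xv (Suc (q + d + e))) (yv (int c)) * dbars q (d + e) g)"
  using assms
proof (induction e)
  case 0
  have "dbars q d (column_factor (Suc (q + d)) c * g) = column_factor (Suc (q + d)) c * dbars q d g"
    by (intro dbars_mult_sym swap_x_column_factor) auto
  then show ?case
    by (simp add: column_factor_Suc mult.assoc ddiff_bar_mult_sym swap_x_column_factor)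
next
  case (Suc e)
  let ?p = "Suc (q + d + e)"
  let ?h = "dbars q (d + e) g"
  let ?y = "yv (int c)"
  have sym: "swap_x (Suc ?p) ?h = ?h"
    using Suc.prems[of "Suc ?p"] by (simp add: swap_x_dbars_far)
  \<comment> \<open>Together with the factor \<open>1 - xv (Suc (Suc ?p))\<close> from the definition of \<open>ddiff_bar\<close>, the
     correction term is symmetric under the swap of the next two variables.\<close>
  have vanish: "ddiff_bar (Suc ?p) ((1 - ?y) * (1 - xv (Suc ?p)) * ?h) = 0"
    unfolding ddiff_bar_def
    by (rule ddiff_sym_eq_0) (simp add: swap_x_hom sym mult_ac)
  have add: "ddiff_bar (Suc ?p) (f + f') = ddiff_bar (Suc ?p) f + ddiff_bar (Suc ?p) f'" for f f'
    by (simp add: ddiff_bar_def distrib_left ddiff_add)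
  have "dbars q (Suc (d + Suc e)) (column_factor (Suc (q + d)) c * g) =
      ddiff_bar (Suc ?p) (dbars q (Suc (d + e)) (column_factor (Suc (q + d)) c * g))"
    by (simp add: add.assoc)
  also have "dbars q (Suc (d + e)) (column_factor (Suc (q + d)) c * g) =
      column_factor (q + d) c * ddiff_bar ?p (oplus (xv ?p) ?y * ?h)"
    using Suc by (simp del: dbars.simps)
  also have "ddiff_bar (Suc ?p) \<dots> =
      column_factor (q + d) c * ddiff_bar (Suc ?p) (ddiff_bar ?p (oplus (xv ?p) ?y * ?h))"
    by (intro ddiff_bar_mult_sym swap_x_column_factor) auto
  also have "\<dots> = column_factor (q + d) c *
      ddiff_bar (Suc ?p) (oplus (xv (Suc ?p)) ?y * ddiff_bar ?p ?h)"
    unfolding ddiff_bar_oplus_mult[of ?p] add vanish by simp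
  finally show ?case by (simp add: add.assoc)
qed

text \<open>This identity makes the two recursions fit together. On the left stand the columns of a
  permutation after a large value has been moved to the front of a block of \<open>m\<close> rows, which raises
  each of their heights by one; on the right stand the columns before. By induction on \<open>m\<close>, the
  leftmost and hence highest column supplies, by \<open>dbars_column_factor\<close>, the linear factor of the
  last operator. The remaining heights are smaller than \<open>q + m\<close>, so that their factors leave
  that operator.\<close>

lemma dbars_column_factors:
  assumes "m \<le> j"
    and "\<And>t. t \<in> {1..m} \<Longrightarrow> q \<le> k (j - t) \<and> k (j - t) < q + t"
    and "\<And>c d. j - m \<le> c \<Longrightarrow> c \<le> d \<Longrightarrow> d < j \<Longrightarrow> k d \<le> k c"
    and "\<And>i. i \<in> {q + 2..q + m} \<Longrightarrow> swap_x i h = h"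
  shows "dbars q m ((\<Prod>c\<in>{j - m..<j}. column_factor (Suc (k c)) c) * h) =
    (\<Prod>c\<in>{j - m..<j}. column_factor (k c) c) * pibars q m j h"
  using assms
proof (induction m)
  case 0
  then show ?case by simp
next
  case (Suc m)
  define c where "c = j - Suc m"
  define d where "d = k c - q"
  define e where "e = m - d"
  have c: "{j - Suc m..<j} = insert c {j - m..<j}" "c \<notin> {j - m..<j}"
    using Suc.prems(1) by (auto simp: c_def)
  have kc: "k c = q + d" "d + e = m"
    using Suc.prems(2)[of "Suc m"] by (auto simp: c_def d_def e_def)
  let ?P = "\<lambda>f. \<Prod>c\<in>{j - m..<j}. column_factor (f (k c)) c"
  have kP: "swap_x i (?P Suc * h) = ?P Suc * h" if "i \<in> {q + d + 2..Suc (q + d + e)}" for i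
  proof -
    have "swap_x i (column_factor (Suc (k b)) b) = column_factor (Suc (k b)) b"
      if "b \<in> {j - m..<j}" for b
    proof -
      have "k b \<le> k c" using Suc.prems(3)[of c b] that by (auto simp: c_def)
      with \<open>i \<in> _\<close> kc show ?thesis by (intro swap_x_column_factor) auto
    qed
    moreover have "swap_x i h = h" using that kc by (intro Suc.prems(4)) auto
    ultimately show ?thesis by (simp add: swap_x_hom swap_x_prod)
  qed
  have low: "swap_x (Suc (q + m)) (?P (\<lambda>x. x)) = ?P (\<lambda>x. x)"
  proof -
    have "swap_x (Suc (q + m)) (column_factor (k b) b) = column_factor (k b) b"
      if "b \<in> {j - m..<j}" for b
      using Suc.prems(2)[of "j - b"] that by (intro swap_x_column_factor) force+
    then show ?thesis by (simp add: swap_x_prod)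
  qed
  have IH: "dbars q m (?P Suc * h) = ?P (\<lambda>x. x) * pibars q m j h"
    using Suc.prems by (intro Suc.IH) auto
  have "dbars q (Suc m) ((\<Prod>c\<in>{j - Suc m..<j}. column_factor (Suc (k c)) c) * h) =
      dbars q (Suc (d + e)) (column_factor (Suc (q + d)) c * (?P Suc * h))"
    using c kc by (simp add: mult.assoc del: dbars.simps)
  also have "\<dots> = column_factor (k c) c *
      ddiff_bar (Suc (q + m)) (oplus (xv (Suc (q + m))) (yv (int c)) * dbars q m (?P Suc * h))"
    using dbars_column_factor[of q d e "?P Suc * h" c] kP kc by (simp add: add.assoc del: dbars.simps)
  also have "\<dots> = column_factor (k c) c * (?P (\<lambda>x. x) *
      ddiff_bar (Suc (q + m)) (oplus (xv (Suc (q + m))) (yv (int c)) * pibars q m j h))"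
    unfolding IH by (simp add: ddiff_bar_mult_sym[OF low, symmetric] mult_ac)
  finally show ?case
    using c Suc.prems(1) by (simp add: pi_bar_def c_def of_nat_diff mult.assoc)
qed

text \<open>The coefficient of the monomial \<open>xv a\<close> is one.\<close>

lemma oplus_nonzero: "oplus (xv a) (yv c) \<noteq> 0"
proof
  let ?m = "Poly_Mapping.single (X a) (1::nat)"
  assume "oplus (xv a) (yv c) = 0"
  moreover have "?m \<noteq> Poly_Mapping.single (Y c) (1::nat)"
    "?m \<noteq> ?m + Poly_Mapping.single (Y c) (1::nat)"
    by (metis lookup_single_eq lookup_single_not_eq var.distinct(1) zero_neq_one,
       metis add_cancel_right_right lookup_zero lookup_single_eq zero_neq_one)
  then have "Poly_Mapping.lookup (oplus (xv a) (yv c)) ?m = 1"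
    by (simp add: oplus_def Var_def lookup_add lookup_minus mult_single lookup_single when_def)
  ultimately show False by simp
qed


section \<open>Coxeter length and inversions\<close>

definition position_pairs :: "nat \<Rightarrow> (nat \<times> nat) set" where
  "position_pairs n = {(a, b). 1 \<le> a \<and> a < b \<and> b \<le> n}"

definition inversions :: "nat \<Rightarrow> (nat \<Rightarrow> nat) \<Rightarrow> (nat \<times> nat) set" where
  "inversions n w = {(a, b) \<in> position_pairs n. w b < w a}"

lemma inversions_subset: "inversions n w \<subseteq> position_pairs n"
  by (auto simp: inversions_def)

lemma finite_position_pairs: "finite (position_pairs n)"
  by (rule finite_subset[of _ "{1..n} \<times> {1..n}"]) (auto simp: position_pairs_def)

lemma finite_inversions: "finite (inversions n w)"
  using finite_subset[OF inversions_subset finite_position_pairs] .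

lemma card_inversions_le: "card (inversions n w) \<le> card (position_pairs n)"
  by (rule card_mono[OF finite_position_pairs inversions_subset])

lemma simple_refl_simps [simp]:
  "simple_refl i i = Suc i" "simple_refl i (Suc i) = i"
  "a \<noteq> i \<Longrightarrow> a \<noteq> Suc i \<Longrightarrow> simple_refl i a = a"
  by (simp_all add: simple_refl_def)

lemma simple_refl_involutive [simp]: "simple_refl i (simple_refl i a) = a"
  by (simp add: simple_refl_def)

lemma comp_simple_refl_twice [simp]: "w \<circ> simple_refl i \<circ> simple_refl i = w"
  by (simp add: fun_eq_iff)

lemma simple_refl_permutes: "i \<in> {1..<n} \<Longrightarrow> simple_refl i permutes {1..n}"
  unfolding simple_refl_def by (rule permutes_swap_id) auto

lemma permutes_comp_simple_refl:
  "w permutes {1..n} \<Longrightarrow> i \<in> {1..<n} \<Longrightarrow> w \<circ> simple_refl i permutes {1..n}"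
  by (rule permutes_compose[OF simple_refl_permutes])

text \<open>Apart from the new inversion \<open>(i, i + 1)\<close>, applying \<open>s\<^sub>i\<close> to both positions is a bijection
  between the inversions of \<open>w\<close> and those of \<open>w s\<^sub>i\<close>.\<close>

lemma card_inversions_ascent:
  assumes "i \<in> {1..<n}" "w i < w (Suc i)"
  shows "card (inversions n (w \<circ> simple_refl i)) = Suc (card (inversions n w))"
proof -
  let ?s = "simple_refl i"
  let ?S = "\<lambda>(a, b). (?s a, ?s b)"
  have mem: "?S p \<in> inversions n v"
    if "p \<in> inversions n (v \<circ> ?s)" "p \<noteq> (i, Suc i)" for p v
    using that assms(1) unfolding inversions_def position_pairs_def
    by (auto simp: simple_refl_def transpose_def split: if_splits)
  have "inversions n (w \<circ> ?s) = insert (i, Suc i) (?S ` inversions n w)"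
  proof (intro equalityI subsetI)
    fix p assume "p \<in> inversions n (w \<circ> ?s)"
    moreover have "p = ?S (?S p)" by (cases p) simp
    ultimately show "p \<in> insert (i, Suc i) (?S ` inversions n w)"
      using mem[of p w] by blast
  next
    fix p assume "p \<in> insert (i, Suc i) (?S ` inversions n w)"
    then consider "p = (i, Suc i)" | q where "q \<in> inversions n w" "p = ?S q" by blast
    then show "p \<in> inversions n (w \<circ> ?s)"
    proof cases
      case 1
      then show ?thesis using assms by (simp add: inversions_def position_pairs_def)
    next
      case 2
      then have "q \<noteq> (i, Suc i)" using assms by (auto simp: inversions_def)
      with 2 show ?thesis using mem[of q "w \<circ> ?s"] by simp
    qed
  qed
  moreover have "(i, Suc i) \<notin> ?S ` inversions n w"
  proof
    assume "(i, Suc i) \<in> ?S ` inversions n w"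
    then obtain a b where "(a, b) \<in> inversions n w" "?s a = i" "?s b = Suc i" by auto
    moreover from this have "a = Suc i" "b = i" by (metis simple_refl_involutive simple_refl_simps)+
    ultimately show False by (simp add: inversions_def position_pairs_def)
  qed
  moreover have "inj_on ?S (inversions n w)"
    by (rule inj_on_inverseI[of _ ?S]) auto
  ultimately show ?thesis by (simp add: finite_inversions card_image)
qed

lemma card_inversions_descent:
  assumes "i \<in> {1..<n}" "w (Suc i) < w i"
  shows "card (inversions n w) = Suc (card (inversions n (w \<circ> simple_refl i)))"
  using card_inversions_ascent[of i n "w \<circ> simple_refl i"] assms by simp

lemma permutes_adjacent_neq:
  assumes "w permutes {1..n}"
  shows "w i \<noteq> w (Suc i)"
  using inj_eq[OF permutes_inj[OF assms], of i "Suc i"] by simp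

abbreviation word_perm :: "nat list \<Rightarrow> nat \<Rightarrow> nat" where
  "word_perm is \<equiv> foldr (\<lambda>i v. simple_refl i \<circ> v) is id"

lemma word_perm_snoc: "word_perm (is @ [i]) = word_perm is \<circ> simple_refl i"
proof -
  have "foldr (\<lambda>i v. simple_refl i \<circ> v) is u = word_perm is \<circ> u" for u
    by (induction "is") (simp_all add: comp_assoc)
  then show ?thesis by simp
qed

text \<open>Each letter of a word changes the number of inversions by at most one, so this number is a
  lower bound for the length; \<open>exists_word\<close> attains it by sorting.\<close>

lemma word_perm_bounds:
  assumes "set is \<subseteq> {1..<n}"
  shows "word_perm is permutes {1..n} \<and> card (inversions n (word_perm is)) \<le> length is"
  using assms
proof (induction "is" rule: rev_induct)
  case Nil
  have "inversions n id = {}" by (auto simp: inversions_def position_pairs_def)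
  then show ?case using permutes_id[of "{1..n}"] by (simp add: id_def)
next
  case (snoc i "is")
  let ?w = "word_perm is"
  have "set is \<subseteq> {1..<n}" and i: "i \<in> {1..<n}" using snoc.prems by auto
  from snoc.IH[OF this(1)] have IH: "?w permutes {1..n}" "card (inversions n ?w) \<le> length is"
    by blast+
  have "card (inversions n (?w \<circ> simple_refl i)) \<le> Suc (card (inversions n ?w))"
    using card_inversions_ascent[OF i, of ?w] card_inversions_descent[OF i, of ?w]
      permutes_adjacent_neq[OF IH(1), of i] by linarith
  with IH(2) show ?case
    using permutes_comp_simple_refl[OF IH(1) i]
    unfolding word_perm_snoc length_append_singleton by (intro conjI) (assumption, linarith)
qed

lemma permutes_increasing_id:
  assumes w: "w permutes {1..n}" and inc: "\<And>i. i \<in> {1..<n} \<Longrightarrow> w i < w (Suc i)"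
  shows "w = id"
proof
  fix a
  have gap: "w a + (b - a) \<le> w b" if "a \<le> b" "1 \<le> a" "b \<le> n" for a b
    using that
  proof (induction b rule: dec_induct)
    case (step b)
    then show ?case using inc[of b] by simp
  qed simp
  show "w a = id a"
  proof (cases "a \<in> {1..n}")
    case True
    then have "w 1 \<in> {1..n}" "w n \<in> {1..n}" by (simp_all only: permutes_in_image[OF w], auto)
    with True gap[of 1 a] gap[of a n] show ?thesis by auto
  qed (simp add: permutes_not_in[OF w])
qed

text \<open>The longest element \<open>w\<^sub>0\<close>, in closed form.\<close>

definition reversal :: "nat \<Rightarrow> nat \<Rightarrow> nat" where
  "reversal n a = (if a \<in> {1..n} then Suc n - a else a)"

lemma reversal_permutes: "reversal n permutes {1..n}"
proof (rule bij_imp_permutes)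
  show "bij_betw (reversal n) {1..n} {1..n}"
    by (rule bij_betwI[of _ _ _ "reversal n"]) (auto simp: reversal_def)
qed (auto simp: reversal_def)

lemma permutes_decreasing_reversal:
  assumes w: "w permutes {1..n}" and dec: "\<And>i. i \<in> {1..<n} \<Longrightarrow> w (Suc i) < w i"
  shows "w = reversal n"
proof
  fix a
  have gap: "w b + (b - a) \<le> w a" if "a \<le> b" "1 \<le> a" "b \<le> n" for a b
    using that
  proof (induction b rule: dec_induct)
    case (step b)
    then show ?case using dec[of b] by simp
  qed simp
  show "w a = reversal n a"
  proof (cases "a \<in> {1..n}")
    case True
    then have "w 1 \<in> {1..n}" "w n \<in> {1..n}" by (simp_all only: permutes_in_image[OF w], auto)
    with True gap[of 1 a] gap[of a n] show ?thesis by (auto simp: reversal_def)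
  qed (auto simp: permutes_not_in[OF w] reversal_def)
qed

lemma exists_word:
  assumes "w permutes {1..n}"
  shows "\<exists>is. length is = card (inversions n w) \<and> set is \<subseteq> {1..<n} \<and> w = word_perm is"
  using assms
proof (induction "card (inversions n w)" arbitrary: w rule: less_induct)
  case less
  show ?case
  proof (cases "\<forall>i\<in>{1..<n}. w i < w (Suc i)")
    case True
    then have "w = id" using permutes_increasing_id[OF less.prems] by blast
    moreover have "inversions n id = {}" by (auto simp: inversions_def position_pairs_def)
    ultimately show ?thesis by (intro exI[of _ "[]"]) simp
  next
    case False
    then obtain i where i: "i \<in> {1..<n}" "w (Suc i) < w i"
      using permutes_adjacent_neq[OF less.prems] by (metis linorder_less_linear)
    obtain "is" where "is": "length is = card (inversions n (w \<circ> simple_refl i))"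
      "set is \<subseteq> {1..<n}" "w \<circ> simple_refl i = word_perm is"
      using less.hyps[of "w \<circ> simple_refl i"] card_inversions_descent[of i n w] i
        permutes_comp_simple_refl[OF less.prems, of i] by auto
    have "w = word_perm (is @ [i])"
      unfolding word_perm_snoc "is"(3)[symmetric] by simp
    then show ?thesis
      using "is" i card_inversions_descent[of i n w] by (intro exI[of _ "is @ [i]"]) auto
  qed
qed

lemma coxeter_length_eq:
  assumes "w permutes {1..n}"
  shows "coxeter_length n w = card (inversions n w)"
  unfolding coxeter_length_def
proof (rule Least_equality)
  show "\<exists>is. length is = card (inversions n w) \<and> set is \<subseteq> {1..<n} \<and> w = word_perm is"
    using exists_word[OF assms] .
qed (use word_perm_bounds in auto)

lemma coxeter_length_ascent_iff:
  assumes "w permutes {1..n}" "i \<in> {1..<n}"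
  shows "coxeter_length n w < coxeter_length n (w \<circ> simple_refl i) \<longleftrightarrow> w i < w (Suc i)"
  unfolding coxeter_length_eq[OF assms(1)] coxeter_length_eq[OF permutes_comp_simple_refl[OF assms]]
  using card_inversions_ascent[OF assms(2), of w] card_inversions_descent[OF assms(2), of w]
    permutes_adjacent_neq[OF assms(1), of i]
  by linarith

lemma inversions_reversal: "inversions n (reversal n) = position_pairs n"
  by (auto simp: inversions_def position_pairs_def reversal_def)

text \<open>A permutation of maximal length inverts all pairs of positions and is therefore decreasing.\<close>

lemma longest_perm_eq: "longest_perm n = reversal n"
  unfolding longest_perm_def
proof (rule the_equality)
  show "reversal n permutes {1..n} \<and>
      (\<forall>v. v permutes {1..n} \<longrightarrow> coxeter_length n v \<le> coxeter_length n (reversal n))"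
    using reversal_permutes[of n] card_inversions_le[of n]
    by (simp add: coxeter_length_eq inversions_reversal)
next
  fix w
  assume w: "w permutes {1..n} \<and>
      (\<forall>v. v permutes {1..n} \<longrightarrow> coxeter_length n v \<le> coxeter_length n w)"
  then have "card (position_pairs n) \<le> card (inversions n w)"
    using reversal_permutes[of n] inversions_reversal[of n] by (metis coxeter_length_eq)
  then have "inversions n w = position_pairs n"
    using finite_position_pairs inversions_subset by (metis card_seteq)
  then have "w (Suc i) < w i" if "i \<in> {1..<n}" for i
    using that by (auto simp: inversions_def position_pairs_def)
  then show "w = reversal n"
    using w by (intro permutes_decreasing_reversal) auto
qed


section \<open>The recursion for double Grothendieck polynomials\<close>

text \<open>By the diamond lemma, all runs of the recursion agree: two different ascents \<open>i < k\<close> of a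
  permutation lead back to a common one after one more step (if \<open>i + 1 < k\<close>) or two more steps
  (if \<open>k = i + 1\<close>), and the operators along the two paths agree by the commutation and the braid
  relation.\<close>

lemma is_double_grothendieck_ascent:
  assumes "w permutes {1..n}" "i \<in> {1..<n}" "w i < w (Suc i)"
    "is_double_grothendieck n (w \<circ> simple_refl i) f"
  shows "is_double_grothendieck n w (ddiff_bar i f)"
  using assms by (intro is_double_grothendieck.ascent) (simp_all add: coxeter_length_ascent_iff)

lemma is_double_grothendieck_cases:
  assumes "is_double_grothendieck n w f"
  obtains "w = reversal n"
    "f = (\<Prod>(i, j) \<in> {(i, j). 1 \<le> i \<and> 1 \<le> j \<and> i + j \<le> n}. oplus (xv i) (yv (int j)))"
  | i g where "w permutes {1..n}" "i \<in> {1..<n}" "w i < w (Suc i)" "f = ddiff_bar i g"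
    "is_double_grothendieck n (w \<circ> simple_refl i) g"
  using assms
proof (cases rule: is_double_grothendieck.cases)
  case longest
  then show ?thesis using that(1) longest_perm_eq by simp
next
  case (ascent i g)
  then show ?thesis using that(2) coxeter_length_ascent_iff by metis
qed

lemma reversal_no_ascent: "i \<in> {1..<n} \<Longrightarrow> \<not> reversal n i < reversal n (Suc i)"
  by (auto simp: reversal_def)

text \<open>The recursion goes up in length, so inductions along it use the colength of \<open>w\<close>.\<close>

definition coinversions :: "nat \<Rightarrow> (nat \<Rightarrow> nat) \<Rightarrow> nat" where
  "coinversions n w = card (position_pairs n) - card (inversions n w)"

lemma coinversions_ascent:
  assumes "i \<in> {1..<n}" "w i < w (Suc i)"
  shows "coinversions n (w \<circ> simple_refl i) < coinversions n w"
  using card_inversions_ascent[OF assms] card_inversions_le[of n "w \<circ> simple_refl i"]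
  by (simp add: coinversions_def)

text \<open>That there is no earlier ascent matters for dominant permutations.\<close>

lemma obtain_ascent:
  assumes "w permutes {1..n}" "w \<noteq> reversal n"
  obtains i where "i \<in> {1..<n}" "w i < w (Suc i)" "\<And>k. k \<in> {1..<i} \<Longrightarrow> w (Suc k) < w k"
proof -
  let ?P = "\<lambda>i. i \<in> {1..<n} \<and> w i < w (Suc i)"
  have "\<exists>i. ?P i"
    using permutes_decreasing_reversal[OF assms(1)] assms(2) permutes_adjacent_neq[OF assms(1)]
    by (metis linorder_less_linear)
  then have "?P (Least ?P)" by (rule LeastI_ex)
  moreover have "w (Suc k) < w k" if "k \<in> {1..<Least ?P}" for k
  proof -
    have "\<not> ?P k" using that not_less_Least[of k ?P] by simp
    with that \<open>?P (Least ?P)\<close> show ?thesis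
      using permutes_adjacent_neq[OF assms(1), of k] by auto
  qed
  ultimately show ?thesis using that by blast
qed

lemma is_double_grothendieck_exists:
  assumes "w permutes {1..n}"
  shows "\<exists>f. is_double_grothendieck n w f"
  using assms
proof (induction "coinversions n w" arbitrary: w rule: less_induct)
  case less
  show ?case
  proof (cases "w = reversal n")
    case True
    then show ?thesis using is_double_grothendieck.longest[of n] by (auto simp: longest_perm_eq)
  next
    case False
    then obtain i where i: "i \<in> {1..<n}" "w i < w (Suc i)"
      using obtain_ascent[OF less.prems] by blast
    then obtain f where "is_double_grothendieck n (w \<circ> simple_refl i) f"
      using less.hyps[OF coinversions_ascent[OF i]] permutes_comp_simple_refl[OF less.prems] by blast
    then show ?thesis using is_double_grothendieck_ascent[OF less.prems i] by blast
  qed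
qed

lemma is_double_grothendieck_unique:
  assumes "w permutes {1..n}" "is_double_grothendieck n w f" "is_double_grothendieck n w g"
  shows "f = g"
  using assms
proof (induction "coinversions n w" arbitrary: w f g rule: less_induct)
  case less
  let ?G = "is_double_grothendieck n"
  have diamond: "ddiff_bar i f' = ddiff_bar k g'"
    if i: "i \<in> {1..<n}" "w i < w (Suc i)" "?G (w \<circ> simple_refl i) f'"
      and k: "k \<in> {1..<n}" "w k < w (Suc k)" "?G (w \<circ> simple_refl k) g'"
      and "i < k" for i k f' g'
  proof -
    have wi: "w \<circ> simple_refl i permutes {1..n}" and wk: "w \<circ> simple_refl k permutes {1..n}"
      using permutes_comp_simple_refl[OF less.prems(1)] i(1) k(1) by blast+
    have f': "f' = h" if "?G (w \<circ> simple_refl i) h" for h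
      using less.hyps[OF coinversions_ascent[OF i(1,2)] wi i(3) that] .
    have g': "g' = h" if "?G (w \<circ> simple_refl k) h" for h
      using less.hyps[OF coinversions_ascent[OF k(1,2)] wk k(3) that] .
    show ?thesis
    proof (cases "Suc i = k")
      case False
      with \<open>i < k\<close> have "Suc i < k" by simp
      then have eq: "w \<circ> simple_refl k \<circ> simple_refl i = w \<circ> simple_refl i \<circ> simple_refl k"
        by (auto simp: fun_eq_iff simple_refl_def transpose_def)
      obtain h where h: "?G (w \<circ> simple_refl i \<circ> simple_refl k) h"
        using is_double_grothendieck_exists[OF permutes_comp_simple_refl[OF wi k(1)]] by blast
      have "f' = ddiff_bar k h"
        using \<open>Suc i < k\<close> k by (intro f' is_double_grothendieck_ascent[OF wi k(1) _ h]) simp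
      moreover have "g' = ddiff_bar i h"
        using \<open>Suc i < k\<close> i h
        by (intro g' is_double_grothendieck_ascent[OF wk i(1)]) (simp_all add: eq)
      ultimately show ?thesis using ddiff_bar_commute[OF \<open>Suc i < k\<close>] by simp
    next
      case True
      let ?v = "w \<circ> simple_refl i \<circ> simple_refl k" and ?u = "w \<circ> simple_refl k \<circ> simple_refl i"
      have v: "?v permutes {1..n}" and u: "?u permutes {1..n}"
        by (rule permutes_comp_simple_refl[OF wi k(1)] permutes_comp_simple_refl[OF wk i(1)])+
      have eq: "?u \<circ> simple_refl k = ?v \<circ> simple_refl i"
        using True by (auto simp: fun_eq_iff simple_refl_def transpose_def)
      obtain h where h: "?G (?v \<circ> simple_refl i) h"
        using is_double_grothendieck_exists[OF permutes_comp_simple_refl[OF v i(1)]] by blast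
      have "?G ?v (ddiff_bar i h)"
        using True k by (intro is_double_grothendieck_ascent[OF v i(1) _ h]) auto
      then have "f' = ddiff_bar k (ddiff_bar i h)"
        using True i k by (intro f' is_double_grothendieck_ascent[OF wi k(1)]) auto
      moreover have "?G ?u (ddiff_bar k h)"
        using True i h by (intro is_double_grothendieck_ascent[OF u k(1)]) (auto simp: eq)
      then have "g' = ddiff_bar i (ddiff_bar k h)"
        using True i k by (intro g' is_double_grothendieck_ascent[OF wk i(1)]) auto
      ultimately show ?thesis using ddiff_bar_braid[of i h] True by simp
    qed
  qed
  show ?case
  proof (cases rule: is_double_grothendieck_cases[OF less.prems(2)])
    case f: 1
    then show ?thesis
      by (cases rule: is_double_grothendieck_cases[OF less.prems(3)])
        (auto simp: reversal_no_ascent)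
  next
    case f: (2 i f')
    show ?thesis
    proof (cases rule: is_double_grothendieck_cases[OF less.prems(3)])
      case 1
      then show ?thesis using f reversal_no_ascent by blast
    next
      case g: (2 k g')
      consider "i < k" | "k < i" | "i = k" by linarith
      then show ?thesis
      proof cases
        case 1
        then show ?thesis using diamond f g by blast
      next
        case 2
        then show ?thesis using diamond[OF g(2,3,5) f(2,3,5)] f g by simp
      next
        case 3
        have "f' = g'"
          using f g 3 less.hyps[OF coinversions_ascent[OF f(2,3)]]
          by (metis permutes_comp_simple_refl)
        with 3 f g show ?thesis by simp
      qed
    qed
  qed
qed

lemma double_grothendieck_eqI:
  assumes "w permutes {1..n}" "is_double_grothendieck n w f"
  shows "double_grothendieck n w = f"
  unfolding double_grothendieck_def
  using assms is_double_grothendieck_unique by (intro the_equality) auto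

lemma double_grothendieck_reversal:
  "double_grothendieck n (reversal n) =
    (\<Prod>(i, j) \<in> {(i, j). 1 \<le> i \<and> 1 \<le> j \<and> i + j \<le> n}. oplus (xv i) (yv (int j)))"
  using is_double_grothendieck.longest[of n]
  by (intro double_grothendieck_eqI reversal_permutes) (simp add: longest_perm_eq)

lemma double_grothendieck_ascent:
  assumes "w permutes {1..n}" "i \<in> {1..<n}" "w i < w (Suc i)"
  shows "double_grothendieck n w = ddiff_bar i (double_grothendieck n (w \<circ> simple_refl i))"
proof -
  obtain f where f: "is_double_grothendieck n (w \<circ> simple_refl i) f"
    using is_double_grothendieck_exists[OF permutes_comp_simple_refl[OF assms(1,2)]] by blast
  then show ?thesis
    using is_double_grothendieck_ascent[OF assms f] double_grothendieck_eqI assms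
      permutes_comp_simple_refl[OF assms(1,2)] by metis
qed


section \<open>Columns of Rothe diagrams\<close>

definition is_initial :: "nat set \<Rightarrow> bool" where
  "is_initial C \<longleftrightarrow> (\<exists>k. C = {1..k})"

definition initial_factor :: "nat set \<Rightarrow> nat \<Rightarrow> polynomial" where
  "initial_factor C c = (if is_initial C then \<Prod>b\<in>C. oplus (xv b) (yv (int c)) else 1)"

text \<open>The factor of \<open>ortho_polynomial\<close> in front of the operators, arranged by columns instead of by
  heights. Columns that are not initial contribute \<open>1\<close>, as do empty ones.\<close>

definition initial_product :: "nat \<Rightarrow> diagram \<Rightarrow> polynomial" where
  "initial_product n D = (\<Prod>c\<in>{1..n}. initial_factor (column D c) c)"

lemma is_initial_empty [simp]: "is_initial {}"
  by (auto simp: is_initial_def intro!: exI[of _ 0])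

lemma is_initial_atLeastAtMost [simp]: "is_initial {Suc 0..k}"
  by (auto simp: is_initial_def)

lemma initial_factor_atLeastAtMost: "initial_factor {Suc 0..k} c = column_factor k c"
  by (simp add: initial_factor_def column_factor_def)

lemma initial_product_nonzero: "initial_product n D \<noteq> 0"
proof -
  have "initial_factor C c \<noteq> 0" for C c
    by (auto simp: is_initial_def initial_factor_def oplus_nonzero)
  then show ?thesis by (simp add: initial_product_def)
qed

lemma swap_x_initial_factor:
  assumes "1 \<le> i" "C \<noteq> {1..i}"
  shows "swap_x i (initial_factor C c) = initial_factor C c"
proof (cases "is_initial C")
  case True
  then obtain k where "C = {1..k}" by (auto simp: is_initial_def)
  with assms show ?thesis
    by (cases "i = k") (simp_all add: initial_factor_atLeastAtMost swap_x_column_factor)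
qed (simp add: initial_factor_def swap_x_one)

lemma diagram_eqI: "(\<And>c. column A c = column B c) \<Longrightarrow> A = B"
  by (auto simp: column_def)

lemma column_remove_columns: "column (remove_columns J D) c = (if c \<in> J then {} else column D c)"
  by (auto simp: column_def remove_columns_def)

lemma omega_bar_eq: "omega_bar i M = (\<Prod>m\<in>M. column_factor i m)"
  unfolding omega_bar_def column_factor_def by (rule prod.swap)

lemma prod_omega_bar_ortho_K:
  assumes "D \<subseteq> {1..n} \<times> {1..n}"
  shows "(\<Prod>i\<in>{1..n}. omega_bar i (ortho_K D i)) = initial_product n D"
proof -
  have K: "ortho_K D i \<subseteq> {1..n}" if "i \<in> {1..n}" for i
  proof
    fix c assume "c \<in> ortho_K D i"
    then have "1 \<in> column D c" using that by (auto simp: ortho_K_def)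
    then show "c \<in> {1..n}" using assms by (auto simp: column_def)
  qed
  have "(\<Prod>i\<in>{1..n}. omega_bar i (ortho_K D i)) =
      (\<Prod>i\<in>{1..n}. \<Prod>c\<in>ortho_K D i. initial_factor (column D c) c)"
    by (simp add: omega_bar_eq ortho_K_def initial_factor_atLeastAtMost)
  also have "\<dots> = (\<Prod>c\<in>(\<Union>i\<in>{1..n}. ortho_K D i). initial_factor (column D c) c)"
  proof (rule prod.UNION_disjoint[symmetric])
    show "\<forall>i\<in>{1..n}. finite (ortho_K D i)"
      using K finite_subset by blast
    show "\<forall>i\<in>{1..n}. \<forall>k\<in>{1..n}. i \<noteq> k \<longrightarrow> ortho_K D i \<inter> ortho_K D k = {}"
      by (auto simp: ortho_K_def)
  qed simp
  also have "\<dots> = initial_product n D"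
    unfolding initial_product_def
  proof (rule prod.mono_neutral_left)
    show "\<forall>c\<in>{1..n} - (\<Union>i\<in>{1..n}. ortho_K D i). initial_factor (column D c) c = 1"
    proof
      fix c assume c: "c \<in> {1..n} - (\<Union>i\<in>{1..n}. ortho_K D i)"
      show "initial_factor (column D c) c = 1"
      proof (cases "is_initial (column D c)")
        case True
        then obtain k where k: "column D c = {1..k}" by (auto simp: is_initial_def)
        have "k \<le> n"
        proof (rule ccontr)
          assume "\<not> k \<le> n"
          then have "Suc n \<in> column D c" by (simp add: k)
          then show False using assms by (auto simp: column_def)
        qed
        with c k have "k = 0" by (force simp: ortho_K_def)
        with k show ?thesis by (simp add: initial_factor_def)
      qed (simp add: initial_factor_def)
    qed
  qed (use K in blast)+
  finally show ?thesis .
qed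

lemma column_initial_diagram:
  assumes "column D c \<subseteq> {1..n}"
  shows "column (initial_diagram n D) c = (if is_initial (column D c) then {} else column D c)"
proof -
  have empty: "column D c = {}" if "column D c = {1..k}" "k \<notin> {1..n}" for k
  proof (cases "k = 0")
    case False
    then have "k \<in> column D c" using that by simp
    then show ?thesis using assms that by blast
  qed (use that in simp)
  show ?thesis
  proof (cases "c \<in> (\<Union>i\<in>{1..n}. ortho_K D i)")
    case True
    then obtain i where "column D c = {1..i}" unfolding ortho_K_def by blast
    then have "is_initial (column D c)" unfolding is_initial_def by blast
    with True show ?thesis by (simp add: initial_diagram_def column_remove_columns)
  next
    case False
    have "column D c = {}" if init: "is_initial (column D c)"
    proof -
      obtain k where k: "column D c = {1..k}" using init unfolding is_initial_def by blast
      then have "k \<notin> {1..n}" using False unfolding ortho_K_def by blast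
      with k show ?thesis by (rule empty)
    qed
    with False show ?thesis by (simp add: initial_diagram_def column_remove_columns)
  qed
qed

lemma rothe_diagram_subset: "rothe_diagram n w \<subseteq> {1..n} \<times> {1..n}"
  by (auto simp: rothe_diagram_def)

lemma column_rothe_diagram_subset: "column (rothe_diagram n w) c \<subseteq> {1..n}"
  by (auto simp: rothe_diagram_def column_def)

lemma column_rothe_diagram_outside: "c \<notin> {1..n} \<Longrightarrow> column (rothe_diagram n w) c = {}"
  by (auto simp: rothe_diagram_def column_def)

text \<open>It is convenient to index a column by the position \<open>p\<close> of its value, which avoids inverses.\<close>

lemma column_rothe_diagram:
  assumes w: "w permutes {1..n}" and p: "p \<in> {1..n}"
  shows "column (rothe_diagram n w) (w p) = {r. 1 \<le> r \<and> r < p \<and> w p < w r}"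
proof -
  have "w p \<in> {1..n}" using p by (simp only: permutes_in_image[OF w])
  then show ?thesis
    using p by (auto simp: column_def rothe_diagram_def permutes_inverses[OF w])
qed

lemma obtain_position:
  assumes "w permutes {1..n}" "c \<in> {1..n}"
  obtains p where "p \<in> {1..n}" "w p = c"
proof -
  have "c \<in> w ` {1..n}" using assms(2) unfolding permutes_image[OF assms(1)] .
  then show ?thesis using that by (elim imageE) metis
qed

text \<open>The permutations all of whose columns are initial are the dominant ones; for them the
  orthodontic sequence is empty. If such a \<open>w\<close> is not \<open>w\<^sub>0\<close> and \<open>i\<close> is its first ascent, then
  \<open>w s\<^sub>i\<close> is dominant again, with one more box, in row \<open>i\<close> and column \<open>w i\<close>. All other columns
  have a factor symmetric in \<open>x\<^sub>i\<close> and \<open>x\<^sub>i\<^sub>+\<^sub>1\<close>, so \<open>ddiff_bar i\<close> just removes this box by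
  \<open>ddiff_bar_oplus\<close>.\<close>

lemma double_grothendieck_dominant:
  assumes "w permutes {1..n}" "\<And>c. is_initial (column (rothe_diagram n w) c)"
  shows "double_grothendieck n w = initial_product n (rothe_diagram n w)"
  using assms
proof (induction "coinversions n w" arbitrary: w rule: less_induct)
  case less
  note w = less.prems(1)
  let ?C = "\<lambda>w. column (rothe_diagram n w)"
  show ?case
  proof (cases "w = reversal n")
    case True
    have col: "?C w c = {1..n - c}" if "c \<in> {1..n}" for c
    proof -
      have wc: "w (Suc n - c) = c" "Suc n - c \<in> {1..n}"
        using that True by (auto simp: reversal_def)
      then have "?C w c = {r. 1 \<le> r \<and> r < Suc n - c \<and> c < w r}"
        using column_rothe_diagram[OF w wc(2)] by simp
      also have "\<dots> = {1..n - c}"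
        using that by (auto simp: True reversal_def)
      finally show ?thesis .
    qed
    have "(\<Prod>(i, j) \<in> {(i, j). 1 \<le> i \<and> 1 \<le> j \<and> i + j \<le> n}. oplus (xv i) (yv (int j))) =
        (\<Prod>(c, i) \<in> (SIGMA c:{1..n}. {1..n - c}). oplus (xv i) (yv (int c)))"
      by (rule prod.reindex_bij_witness[of _ "\<lambda>(a, b). (b, a)" "\<lambda>(a, b). (b, a)"]) auto
    also have "\<dots> = (\<Prod>c\<in>{1..n}. column_factor (n - c) c)"
      by (simp add: column_factor_def prod.Sigma)
    also have "\<dots> = initial_product n (rothe_diagram n w)"
      unfolding initial_product_def
      by (rule prod.cong) (simp_all add: col initial_factor_atLeastAtMost)
    finally show ?thesis using True double_grothendieck_reversal by simp
  next
    case False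
    obtain i where i: "i \<in> {1..<n}" "w i < w (Suc i)"
      and first: "\<And>k. k \<in> {1..<i} \<Longrightarrow> w (Suc k) < w k"
      using obtain_ascent[OF w False] by blast
    define u where "u = w \<circ> simple_refl i"
    have u: "u permutes {1..n}"
      unfolding u_def by (rule permutes_comp_simple_refl[OF w i(1)])
    have before: "w i < w r" if "1 \<le> r" "r < i" for r
    proof -
      have le: "w i < w r \<or> r = i" if "r \<le> i" "1 \<le> r" for r
        using that
      proof (induction r rule: inc_induct)
        case (step r)
        then show ?case using first[of r] by auto
      qed simp
      show ?thesis using le[of r] that by simp
    qed
    have wi: "w i \<in> {1..n}" using i by (simp only: permutes_in_image[OF w]) auto
    have u_simps: "u i = w (Suc i)" "u (Suc i) = w i" "\<And>r. r \<noteq> i \<Longrightarrow> r \<noteq> Suc i \<Longrightarrow> u r = w r"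
      by (simp_all add: u_def)
    have wcol: "?C w (w i) = {1..i - 1}"
      using i before by (subst column_rothe_diagram[OF w]) auto
    have "w i < u r" if "1 \<le> r" "r \<le> i" for r
      using that i(2) before[of r] u_simps(1) u_simps(3)[of r] by (cases "r = i") simp_all
    then have "{r. 1 \<le> r \<and> r < Suc i \<and> u (Suc i) < u r} = {1..i}"
      using u_simps(2) by auto
    then have "?C u (u (Suc i)) = {1..i}"
      using column_rothe_diagram[OF u, of "Suc i"] i(1) by simp
    then have ucol: "?C u (w i) = {1..i}" by (simp add: u_simps)
    have other: "?C u c = ?C w c \<and> ?C w c \<noteq> {1..i}" if "c \<noteq> w i" for c
    proof (cases "c \<in> {1..n}")
      case False
      then show ?thesis using i by (auto simp: column_rothe_diagram_outside)
    next
      case True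
      then obtain p where p: "p \<in> {1..n}" "w p = c" by (rule obtain_position[OF w])
      with that have "p \<noteq> i" by auto
      have Cw: "?C w c = {r. 1 \<le> r \<and> r < p \<and> c < w r}"
        using column_rothe_diagram[OF w p(1)] p(2) by simp
      consider "p < i" | "p = Suc i" | "Suc i < p" using \<open>p \<noteq> i\<close> by linarith
      then show ?thesis
      proof cases
        case 1
        then have "?C u c = {r. 1 \<le> r \<and> r < p \<and> c < u r}"
          using column_rothe_diagram[OF u p(1)] p(2) u_simps by simp
        then have "?C u c = ?C w c" using 1 Cw u_simps by auto
        moreover have "i \<notin> ?C w c" using 1 Cw by simp
        ultimately show ?thesis using i by auto
      next
        case 2
        have "?C u c = {r. 1 \<le> r \<and> r < i \<and> c < u r}"
          using column_rothe_diagram[OF u, of i] i p(2) 2 u_simps by simp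
        then have "?C u c = ?C w c" using 2 Cw u_simps p(2) i by (auto simp: less_Suc_eq)
        moreover have "i \<notin> ?C w c" using 2 Cw p i by simp
        ultimately show ?thesis using i by auto
      next
        case 3
        then have Cu: "?C u c = {r. 1 \<le> r \<and> r < p \<and> c < u r}"
          using column_rothe_diagram[OF u p(1)] p(2) u_simps by simp
        obtain k where k: "?C w c = {1..k}"
          using less.prems(2)[of c] by (auto simp: is_initial_def)
        have iff: "i \<in> ?C w c \<longleftrightarrow> Suc i \<in> ?C w c"
        proof
          assume "i \<in> ?C w c"
          then show "Suc i \<in> ?C w c" using 3 i Cw by auto
        qed (use k i in auto)
        have "r \<in> ?C u c \<longleftrightarrow> r \<in> ?C w c" for r
          using iff 3 i unfolding Cu Cw by (cases "r = i"; cases "r = Suc i") (auto simp: u_simps)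
        moreover have "?C w c \<noteq> {1..i}"
        proof
          assume "?C w c = {1..i}"
          with iff i show False by auto
        qed
        ultimately show ?thesis by blast
      qed
    qed
    define R where "R = (\<Prod>c\<in>{1..n} - {w i}. initial_factor (?C w c) c)"
    have "R = (\<Prod>c\<in>{1..n} - {w i}. initial_factor (?C u c) c)"
      unfolding R_def using other by (intro prod.cong) auto
    then have pu: "initial_product n (rothe_diagram n u) = column_factor i (w i) * R"
      unfolding initial_product_def using wi ucol
      by (simp add: prod.remove[of _ "w i"] initial_factor_atLeastAtMost)
    have pw: "initial_product n (rothe_diagram n w) = column_factor (i - 1) (w i) * R"
      unfolding initial_product_def R_def using wi wcol
      by (simp add: prod.remove[of _ "w i"] initial_factor_atLeastAtMost)
    have symR: "swap_x i R = R"
      unfolding R_def swap_x_prod using other i by (intro prod.cong) (auto intro: swap_x_initial_factor)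
    have symF: "swap_x i (column_factor (i - 1) (w i)) = column_factor (i - 1) (w i)"
      using i by (intro swap_x_column_factor) auto
    have "is_initial (?C u c)" for c
      using other[of c] ucol less.prems(2)[of c] by (cases "c = w i") auto
    then have "double_grothendieck n u = initial_product n (rothe_diagram n u)"
      using less.hyps[of u] coinversions_ascent[of i n w] i u unfolding u_def by blast
    then have "double_grothendieck n w = ddiff_bar i (column_factor i (w i) * R)"
      using double_grothendieck_ascent[OF w i] pu by (simp add: u_def)
    also have "column_factor i (w i) * R =
        (column_factor (i - 1) (w i) * R) * oplus (xv i) (yv (int (w i)))"
      using i column_factor_Suc[of "i - 1"] by (simp add: mult_ac)
    also have "ddiff_bar i \<dots> = column_factor (i - 1) (w i) * R"
      by (subst ddiff_bar_mult_sym) (simp_all add: swap_x_hom symR symF[simplified] ddiff_bar_oplus)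
    finally show ?thesis using pw by simp
  qed
qed


section \<open>Evaluating the orthodontic sequence\<close>

text \<open>The value of the nested operators of the orthodontic formula when the current diagram is \<open>E\<close>.
  As an inductive predicate it can be followed step by step, and it holds for some value only if
  the diagram becomes empty eventually; this settles the termination of the sequence.\<close>

inductive ortho_value :: "nat \<Rightarrow> diagram \<Rightarrow> polynomial \<Rightarrow> bool" for n where
  empty: "ortho_value n {} 1"
| step: "E \<noteq> {} \<Longrightarrow> ortho_value n (ortho_step n E) f \<Longrightarrow>
    ortho_value n E (pi_bar (step_row n E) (step_index n E)
      (omega_bar (step_row n E) (step_columns n E) * f))"

lemma ortho_value_unique: "ortho_value n E f \<Longrightarrow> ortho_value n E g \<Longrightarrow> f = g"
proof (induction E f arbitrary: g rule: ortho_value.induct)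
  case empty
  then show ?case by (blast elim: ortho_value.cases)
next
  case (step E f)
  note IH = step.IH
  from step.prems show ?case
  proof (cases rule: ortho_value.cases)
    case empty
    with step.hyps(1) show ?thesis by simp
  next
    case (step g')
    from IH[OF step(3)] show ?thesis unfolding step(1) by (rule arg_cong)
  qed
qed

text \<open>The assumption that no earlier diagram is empty makes \<open>ortho_length\<close> the number of steps taken
  by the derivation of \<open>ortho_value\<close>.\<close>

lemma foldr_ortho_value:
  assumes "ortho_value n E f" "ortho_diagram n D k = E" "\<And>l. l < k \<Longrightarrow> ortho_diagram n D l \<noteq> {}"
  shows "k \<le> ortho_length n D \<and>
    foldr (\<lambda>k f. pi_bar (ortho_i n D k) (ortho_j n D k)
        (omega_bar (ortho_i n D k) (ortho_M n D k) * f))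
      [Suc k..<Suc (ortho_length n D)] 1 = f"
  using assms
proof (induction E f arbitrary: k rule: ortho_value.induct)
  case empty
  have "ortho_length n D = k"
    unfolding ortho_length_def
  proof (rule Least_equality)
    show "k \<le> l" if "ortho_diagram n D l = {}" for l
      using that empty(2)[of l] by (cases "l < k") auto
  qed (rule empty(1))
  then show ?case by simp
next
  case (step E f)
  have "ortho_diagram n D (Suc k) = ortho_step n E"
    using step.prems(1) by (simp add: ortho_diagram_def)
  moreover have "ortho_diagram n D l \<noteq> {}" if "l < Suc k" for l
    using that step.prems step.hyps(1) by (cases "l = k") auto
  ultimately have IH: "Suc k \<le> ortho_length n D"
    "foldr (\<lambda>k f. pi_bar (ortho_i n D k) (ortho_j n D k)
        (omega_bar (ortho_i n D k) (ortho_M n D k) * f))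
      [Suc (Suc k)..<Suc (ortho_length n D)] 1 = f"
    using step.IH[of "Suc k"] by blast+
  have "[Suc k..<Suc (ortho_length n D)] = Suc k # [Suc (Suc k)..<Suc (ortho_length n D)]"
    using IH(1) by (intro upt_conv_Cons) simp
  then show ?case
    using IH step.prems(1) by (simp add: ortho_i_def ortho_j_def ortho_M_def del: upt_Suc)
qed

lemma ortho_polynomial_eq:
  assumes "D \<subseteq> {1..n} \<times> {1..n}" "ortho_value n (initial_diagram n D) f"
  shows "ortho_polynomial n D = initial_product n D * f"
  using foldr_ortho_value[OF assms(2), of D 0] prod_omega_bar_ortho_K[OF assms(1)]
  by (simp add: ortho_polynomial_def ortho_diagram_def del: upt_Suc)


section \<open>Filling one gap of the leftmost column\<close>

definition row_image :: "(nat \<Rightarrow> nat) \<Rightarrow> diagram \<Rightarrow> diagram" where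
  "row_image t E = (\<lambda>(r, c). (t r, c)) ` E"

lemma column_row_image: "column (row_image t E) c = t ` column E c"
  by (force simp: column_def row_image_def)

lemma swap_rows_eq: "swap_rows i E = row_image (transpose i (Suc i)) E"
  by (simp add: swap_rows_def row_image_def simple_refl_def)

text \<open>The rows missing up to the first tooth are exactly those of the first gap; their number is
  what the step index subtracts.\<close>

lemma leftmost_gap:
  assumes "Suc (q + m) \<le> n" "1 \<le> m"
    and "\<And>c. c < j \<Longrightarrow> column E c = {}"
    and "{1..q} \<subseteq> column E j" "Suc (q + m) \<in> column E j"
    and "\<And>r. r \<in> {Suc q..q + m} \<Longrightarrow> r \<notin> column E j"
  shows "leftmost_column E = j" "step_row n E = q + m" "step_index n E = int j - int m"
proof -
  show j: "leftmost_column E = j"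
    unfolding leftmost_column_def
  proof (rule Least_equality)
    show "j \<le> c" if "column E c \<noteq> {}" for c
      using assms(3)[of c] that by (cases "c < j") auto
  qed (use assms(5) in auto)
  show i: "step_row n E = q + m"
    unfolding step_row_def j
  proof (rule Least_equality)
    show "missing_tooth n (column E j) (q + m)"
      using assms(1,2,5) assms(6)[of "q + m"] by (simp add: missing_tooth_def)
    show "q + m \<le> i" if "missing_tooth n (column E j) i" for i
    proof (rule ccontr)
      assume "\<not> q + m \<le> i"
      moreover have "i \<notin> {1..q}" "1 \<le> i" "Suc i \<in> column E j"
        using that assms(4) by (auto simp: missing_tooth_def)
      ultimately show False using assms(6)[of "Suc i"] by auto
    qed
  qed
  have "{a \<in> {1..q + m}. a \<notin> column E j} = {Suc q..q + m}"
  proof (rule set_eqI)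
    fix a
    show "a \<in> {a \<in> {1..q + m}. a \<notin> column E j} \<longleftrightarrow> a \<in> {Suc q..q + m}"
      using assms(4) assms(6)[of a] by (cases "a \<le> q") auto
  qed
  then show "step_index n E = int j - int m"
    by (simp add: step_index_def i j)
qed

text \<open>If the rows \<open>q + 1, \<dots>, q + m\<close> of the whole diagram are empty, the next \<open>m\<close> steps move row
  \<open>q + m + 1\<close> through them up to row \<open>q + 1\<close>. Before the last of these steps no column can become
  initial, since row \<open>q + 1\<close> is still empty; so only the last step removes columns.\<close>

lemma ortho_value_gap:
  assumes "Suc (q + m) \<le> n" "1 \<le> m"
    and "\<And>c. c < j \<Longrightarrow> column E c = {}"
    and "{1..q} \<subseteq> column E j" "Suc (q + m) \<in> column E j"
    and "\<And>r c. r \<in> {Suc q..q + m} \<Longrightarrow> r \<notin> column E c"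
    and "E' = row_image (transpose (Suc q) (Suc (q + m))) E"
    and "M = {c. column E' c = {1..Suc q}}"
    and "ortho_value n (remove_columns M E') f"
  shows "ortho_value n E (pibars q m j (omega_bar (Suc q) M * f))"
  using assms(2,1,3-)
proof (induction m arbitrary: E rule: nat_induct_at_least)
  case base
  have i: "step_row n E = Suc q" and J: "step_index n E = int j - 1"
    using leftmost_gap[of q 1 n j E] base by auto
  have "E \<noteq> {}" using base(4) by (auto simp: column_def)
  moreover have "step_columns n E = M" "ortho_step n E = remove_columns M E'"
    using base(6,7) by (simp_all add: step_columns_def ortho_step_def i swap_rows_eq)
  ultimately show ?case
    using ortho_value.step[of E n f] base(8) by (simp add: i J)
next
  case (Suc m)
  let ?i = "q + Suc m"
  have i: "step_row n E = ?i" and J: "step_index n E = int j - int (Suc m)"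
    using leftmost_gap[of q "Suc m" n j E] Suc.prems by auto
  have ne: "E \<noteq> {}" using Suc.prems(4) by (auto simp: column_def)
  define E1 where "E1 = row_image (transpose ?i (Suc ?i)) E"
  have mem: "r \<in> column E1 c \<longleftrightarrow> transpose ?i (Suc ?i) r \<in> column E c" for r c
    by (force simp: E1_def column_row_image image_iff transpose_eq_iff)
  have gap: "r \<notin> column E1 c" if "r \<in> {Suc q..q + m}" for r c
    using that Suc.prems(5)[of r c] by (simp add: mem)
  have "Suc q \<notin> column E1 c" for c
    using gap[of "Suc q"] Suc.hyps by auto
  moreover have "Suc q \<in> {1..?i}" by simp
  ultimately have "column E1 c \<noteq> {1..?i}" for c by metis
  then have cols: "step_columns n E = {}"
    by (simp add: step_columns_def i swap_rows_eq E1_def)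
  then have step: "ortho_step n E = E1"
    by (auto simp: ortho_step_def i swap_rows_eq E1_def remove_columns_def)
  have "ortho_value n E1 (pibars q m j (omega_bar (Suc q) M * f))"
  proof (rule Suc.IH)
    show "column E1 c = {}" if "c < j" for c
      using Suc.prems(2)[OF that] mem by auto
    show "{1..q} \<subseteq> column E1 j" using Suc.prems(3) by (auto simp: mem)
    show "Suc (q + m) \<in> column E1 j" using Suc.prems(4) by (simp add: mem)
    show "E' = row_image (transpose (Suc q) (Suc (q + m))) E1"
    proof (rule diagram_eqI)
      fix c
      have "transpose (Suc q) (Suc ?i) r = transpose (Suc q) ?i (transpose ?i (Suc ?i) r)"
        if "r \<in> column E c" for r
        using that Suc.prems(5)[of r c] by (auto simp: transpose_def)
      then show "column E' c = column (row_image (transpose (Suc q) (Suc (q + m))) E1) c"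
        unfolding Suc.prems(6) E1_def column_row_image image_image by (intro image_cong) auto
    qed
  qed (use Suc.prems gap in auto)
  then show ?case
    using ortho_value.step[OF ne, of n] by (simp add: i J step cols omega_bar_def)
qed


section \<open>The block in front of a missing tooth\<close>

text \<open>Composing with \<open>block_shift q m\<close> moves the value at position \<open>q + m + 1\<close> to position \<open>q + 1\<close> and
  shifts the values in between by one position.\<close>

definition block_shift :: "nat \<Rightarrow> nat \<Rightarrow> nat \<Rightarrow> nat" where
  "block_shift q m r =
    (if r = Suc q then Suc (q + m) else if Suc q < r \<and> r \<le> Suc (q + m) then r - 1 else r)"

lemma block_shift_permutes: 
  assumes "Suc (q + m) \<le> n"
  shows "block_shift q m permutes {1..n}"
proof (rule bij_imp_permutes)
  let ?g = "\<lambda>r. if r = Suc (q + m) then Suc q else if Suc q \<le> r \<and> r \<le> q + m then Suc r else r"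
  show "bij_betw (block_shift q m) {1..n} {1..n}"
    by (rule bij_betwI[of _ _ _ ?g]) (use assms in \<open>auto simp: block_shift_def\<close>)
qed (use assms in \<open>auto simp: block_shift_def\<close>)

text \<open>The large value moves to the left by adjacent swaps, each of them at an ascent.\<close>

lemma double_grothendieck_block_shift:
  assumes "w permutes {1..n}" "Suc (q + m) \<le> n"
    and "\<And>a. a \<in> {Suc q..q + m} \<Longrightarrow> w a < w (Suc (q + m))"
  shows "double_grothendieck n w = dbars q m (double_grothendieck n (w \<circ> block_shift q m))"
  using assms
proof (induction m arbitrary: w)
  case 0
  have "w \<circ> block_shift q 0 = w" by (auto simp: block_shift_def fun_eq_iff)
  then show ?case by simp
next
  case (Suc m)
  let ?i = "Suc (q + m)"
  let ?u = "w \<circ> simple_refl ?i"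
  have i: "?i \<in> {1..<n}" "w ?i < w (Suc ?i)" using Suc.prems(2) Suc.prems(3)[of ?i] by auto
  have "double_grothendieck n ?u = dbars q m (double_grothendieck n (?u \<circ> block_shift q m))"
    using Suc.prems i by (intro Suc.IH permutes_comp_simple_refl) auto
  moreover have "simple_refl ?i (block_shift q m r) = block_shift q (Suc m) r" for r
    by (auto simp: block_shift_def simple_refl_def transpose_def)
  then have "?u \<circ> block_shift q m = w \<circ> block_shift q (Suc m)"
    by (simp add: fun_eq_iff)
  ultimately show ?case
    using double_grothendieck_ascent[OF Suc.prems(1) i] by (simp only: dbars.simps)
qed

text \<open>The measure for the main induction: moving boxes to smaller rows decreases it.\<close>

definition row_sum :: "diagram \<Rightarrow> nat" where
  "row_sum E = (\<Sum>(r, c)\<in>E. r)"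

text \<open>The leftmost column \<open>j\<close> that is not initial contains the rows \<open>1, \<dots>, q\<close>, then misses the rows
  \<open>q + 1, \<dots>, q + m\<close>, and contains row \<open>q + m + 1\<close>. The locale expresses this by the values of \<open>w\<close>
  in these rows; the rows of the gap form the block.\<close>

locale tooth_block =
  fixes n :: nat and w :: "nat \<Rightarrow> nat" and j q m :: nat
  assumes w: "w permutes {1..n}"
    and m: "1 \<le> m" and tooth_le: "Suc (q + m) \<le> n"
    and j: "j \<in> {1..n}"
    and above: "\<And>r. r \<in> {1..q} \<Longrightarrow> j < w r"
    and block: "\<And>r. r \<in> {Suc q..q + m} \<Longrightarrow> w r < j"
    and tooth: "j < w (Suc (q + m))"
    and left: "\<And>c. c < j \<Longrightarrow> is_initial (column (rothe_diagram n w) c)"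
begin

abbreviation rothe_column :: "(nat \<Rightarrow> nat) \<Rightarrow> nat \<Rightarrow> nat set" where
  "rothe_column u c \<equiv> column (rothe_diagram n u) c"

text \<open>By \<open>image_block\<close> below, these are the values that \<open>w\<close> takes in the block.\<close>

definition block_values :: "nat set" where
  "block_values = {j - m..<j}"

definition col_height :: "nat \<Rightarrow> nat" where
  "col_height c = card (rothe_column w c)"

definition rows_swap :: "nat \<Rightarrow> nat" where
  "rows_swap = transpose (Suc q) (Suc (q + m))"

definition current :: diagram where
  "current = initial_diagram n (rothe_diagram n w)"

definition final_columns :: "nat set" where
  "final_columns = {c. column (row_image rows_swap current) c = {1..Suc q}}"

text \<open>The part of the initial product that is not affected when the block moves.\<close>

definition fixed_factor :: polynomial where
  "fixed_factor = (\<Prod>c\<in>{1..n} - block_values. initial_factor (rothe_column w c) c)"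

lemma mem_rothe_column:
  assumes "u permutes {1..n}" "p \<in> {1..n}"
  shows "x \<in> rothe_column u (u p) \<longleftrightarrow> 1 \<le> x \<and> x < p \<and> u p < u x"
  using column_rothe_diagram[OF assms] by simp

text \<open>The column of \<open>w p\<close> is initial and contains row \<open>q + m + 1\<close>, hence also all rows above.\<close>

lemma value_below_block:
  assumes "p \<in> {1..n}" "Suc (q + m) < p" "w p < j" "r \<in> {1..Suc (q + m)}"
  shows "w p < w r"
proof -
  obtain k where k: "rothe_column w (w p) = {1..k}"
    using left[OF assms(3)] by (auto simp: is_initial_def)
  have "Suc (q + m) \<in> rothe_column w (w p)"
    unfolding mem_rothe_column[OF w assms(1)] using assms tooth by simp
  then have "r \<in> rothe_column w (w p)" using assms(4) k by simp
  then show ?thesis unfolding mem_rothe_column[OF w assms(1)] by simp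
qed

text \<open>The values in the block are smaller than \<open>j\<close>, and they are closed upwards among the values
  below \<open>j\<close>: such a value cannot be taken in the first \<open>q\<close> rows or in row \<open>q + m + 1\<close>, where all
  values exceed \<open>j\<close>, and by \<open>value_below_block\<close> a value taken further down is smaller than all
  values of the block.\<close>

lemma image_block: "w ` {Suc q..q + m} = block_values" and m_le_j: "m \<le> j"
proof -
  let ?S = "w ` {Suc q..q + m}"
  have card: "card ?S = m"
    by (subst card_image) (auto intro: inj_on_subset[OF permutes_inj[OF w]])
  have in_n: "w r \<in> {1..n} \<longleftrightarrow> r \<in> {1..n}" for r by (rule permutes_in_image[OF w])
  have up: "d \<in> ?S" if cd: "c \<in> ?S" "c \<le> d" "d < j" for c d
  proof -
    obtain r where r: "r \<in> {Suc q..q + m}" "c = w r" using cd(1) by blast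
    have "w r \<in> {1..n}" unfolding in_n using r tooth_le by simp
    then have "d \<in> {1..n}" using cd r j by simp
    then obtain p where p: "p \<in> {1..n}" "w p = d" by (rule obtain_position[OF w])
    have "\<not> Suc (q + m) < p"
      using value_below_block[of p r] p r cd by auto
    moreover have "p \<noteq> Suc (q + m)" using tooth p cd by auto
    moreover have "\<not> p \<le> q" using above[of p] p cd by auto
    ultimately have "p \<in> {Suc q..q + m}" by simp
    with p show ?thesis by blast
  qed
  have sub: "c < j" if "c \<in> ?S" for c using block that by auto
  define a where "a = Min ?S"
  have a: "a \<in> ?S" unfolding a_def using m by (intro Min_in) auto
  have S: "?S = {a..<j}"
  proof (intro equalityI subsetI)
    fix d assume "d \<in> ?S"
    then show "d \<in> {a..<j}" using sub by (simp add: a_def)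
  next
    fix d assume "d \<in> {a..<j}"
    then show "d \<in> ?S" using up[OF a] by simp
  qed
  have "j - a = m" using card unfolding S by simp
  moreover have "a < j" by (rule sub[OF a])
  ultimately have "m \<le> j" "a = j - m" by linarith+
  then show "?S = block_values" "m \<le> j" unfolding block_values_def using S by simp_all
qed

lemma obtain_block_position:
  assumes "c \<in> block_values"
  obtains r where "r \<in> {Suc q..q + m}" "r \<in> {1..n}" "w r = c"
proof -
  from assms obtain r where "r \<in> {Suc q..q + m}" "c = w r"
    unfolding image_block[symmetric] by (rule imageE)
  with that[of r] tooth_le show ?thesis by simp
qed

lemma block_values_subset: "block_values \<subseteq> {1..n}"
proof
  fix c assume "c \<in> block_values"
  then obtain r where "r \<in> {1..n}" "w r = c" by (rule obtain_block_position)
  then show "c \<in> {1..n}" by (metis permutes_in_image[OF w])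
qed

lemma block_column:
  assumes "c \<in> block_values"
  shows "rothe_column w c = {1..col_height c}"
proof -
  have "c < j" using assms by (simp add: block_values_def)
  then obtain k where k: "rothe_column w c = {1..k}"
    using left unfolding is_initial_def by blast
  show ?thesis unfolding col_height_def k by simp
qed

lemma block_column_iff:
  assumes "c \<in> block_values" "r \<in> {Suc q..q + m}" "w r = c" "1 \<le> x"
  shows "x \<le> col_height c \<longleftrightarrow> x < r \<and> c < w x"
proof -
  have "r \<in> {1..n}" using assms(2) tooth_le by simp
  from mem_rothe_column[OF w this, of x] show ?thesis
    unfolding assms(3) block_column[OF assms(1)] using assms(4) by simp
qed

lemma col_height_bounds:
  assumes "c \<in> block_values" "r \<in> {Suc q..q + m}" "w r = c"
  shows "q \<le> col_height c" "col_height c < r"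
proof -
  show "q \<le> col_height c"
  proof (cases "q = 0")
    case False
    have "c < j" using assms(1) by (simp add: block_values_def)
    also have "j < w q" using False by (intro above) simp
    finally show ?thesis using block_column_iff[OF assms, of q] False assms(2) by simp
  qed simp
  show "col_height c < r"
  proof (cases "col_height c = 0")
    case True
    with assms(2) show ?thesis by simp
  next
    case False
    then show ?thesis using block_column_iff[OF assms, of "col_height c"] by simp
  qed
qed

text \<open>If column \<open>d\<close> were higher than a column \<open>c\<close> to its left, the row just below column \<open>c\<close> would
  carry a value above \<open>d\<close>; then this row lies in column \<open>c\<close> too, or it carries the value \<open>c\<close>
  itself; both are impossible.\<close>

lemma col_height_antitone:
  assumes "c \<in> block_values" "d \<in> block_values" "c \<le> d"
  shows "col_height d \<le> col_height c"
proof (rule ccontr)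
  assume less: "\<not> col_height d \<le> col_height c"
  obtain r where r: "r \<in> {Suc q..q + m}" "w r = c" by (rule obtain_block_position[OF assms(1)])
  obtain r' where r': "r' \<in> {Suc q..q + m}" "w r' = d" by (rule obtain_block_position[OF assms(2)])
  define x where "x = Suc (col_height c)"
  have "d < w x"
    using block_column_iff[OF assms(2) r', of x] less by (simp add: x_def)
  moreover have "\<not> (x < r \<and> c < w x)"
    using block_column_iff[OF assms(1) r, of x] by (simp add: x_def)
  moreover have "x \<le> r"
    using col_height_bounds(2)[OF assms(1) r] by (simp add: x_def)
  ultimately have "r = x" using assms(3) by linarith
  with r(2) assms(3) \<open>d < w x\<close> show False by simp
qed

text \<open>The rows of the block in the column \<open>j - t\<close> carry different values strictly between \<open>j - t\<close>
  and \<open>j\<close>.\<close>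

lemma col_height_less:
  assumes "t \<in> {1..m}"
  shows "q \<le> col_height (j - t) \<and> col_height (j - t) < q + t"
proof -
  define c where "c = j - t"
  have c: "c \<in> block_values" using assms m_le_j by (auto simp: block_values_def c_def)
  then obtain r where r: "r \<in> {Suc q..q + m}" "w r = c" by (rule obtain_block_position)
  note kb = col_height_bounds[OF c r]
  have "w x \<in> {Suc c..<j}" if "x \<in> {Suc q..col_height c}" for x
  proof -
    have "c < w x" using block_column_iff[OF c r, of x] that by simp
    moreover have "w x < j" using that kb(2) r(1) by (intro block) simp
    ultimately show ?thesis by simp
  qed
  then have "card (w ` {Suc q..col_height c}) \<le> card {Suc c..<j}"
    by (intro card_mono) auto
  moreover have "card (w ` {Suc q..col_height c}) = col_height c - q"
    by (subst card_image) (simp_all add: inj_on_subset[OF permutes_inj[OF w]])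
  moreover have "c + t = j" "1 \<le> t" using assms m_le_j by (auto simp: c_def)
  ultimately have "q \<le> col_height c \<and> col_height c < q + t" using kb(1) by simp
  then show ?thesis by (simp only: c_def)
qed

lemma rows_swap_simps [simp]:
  "rows_swap (Suc q) = Suc (q + m)" "rows_swap (Suc (q + m)) = Suc q"
  "x \<noteq> Suc q \<Longrightarrow> x \<noteq> Suc (q + m) \<Longrightarrow> rows_swap x = x"
  by (simp_all add: rows_swap_def)

lemma mem_image_rows_swap: "x \<in> rows_swap ` A \<longleftrightarrow> rows_swap x \<in> A"
  by (force simp: rows_swap_def image_iff transpose_eq_iff)

lemma column_right_gap:
  assumes "j \<le> c" "r \<in> {Suc q..q + m}"
  shows "r \<notin> rothe_column w c"
proof (cases "c \<in> {1..n}")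
  case True
  then obtain p where "p \<in> {1..n}" "w p = c" by (rule obtain_position[OF w])
  then show ?thesis
    using mem_rothe_column[OF w, of p r] block[OF assms(2)] assms(1) by auto
qed (simp add: column_rothe_diagram_outside)

lemma column_right_initial:
  assumes "j \<le> c" "rothe_column w c = {1..k}"
  shows "k \<le> q"
  using column_right_gap[OF assms(1), of "Suc q"] m unfolding assms(2) by simp

lemma column_right_swap_initial:
  assumes "j \<le> c" "is_initial (rothe_column w c)"
  shows "rows_swap ` rothe_column w c = rothe_column w c"
proof -
  obtain k where k: "rothe_column w c = {1..k}" using assms(2) by (auto simp: is_initial_def)
  have "rows_swap x = x" if "x \<in> {1..k}" for x
    using that column_right_initial[OF assms(1) k] by (intro rows_swap_simps) auto
  then show ?thesis unfolding k by simp
qed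

lemma column_right_swap_not_initial:
  assumes "j \<le> c" "\<not> is_initial (rothe_column w c)" "rows_swap ` rothe_column w c = {1..k}"
  shows "k = Suc q"
proof (rule ccontr)
  assume "k \<noteq> Suc q"
  have "\<not> Suc (Suc q) \<le> k"
  proof
    assume "Suc (Suc q) \<le> k"
    then have "Suc (Suc q) \<in> rows_swap ` rothe_column w c" unfolding assms(3) by simp
    then have "rows_swap (Suc (Suc q)) \<in> rothe_column w c" unfolding mem_image_rows_swap .
    moreover have "rows_swap (Suc (Suc q)) \<in> {Suc q..q + m}"
      unfolding rows_swap_def using m by (cases "m = 1") (auto simp: transpose_def)
    ultimately show False using column_right_gap[OF assms(1)] by blast
  qed
  with \<open>k \<noteq> Suc q\<close> have "k \<le> q" by simp
  have "rothe_column w c = rows_swap ` rows_swap ` rothe_column w c"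
    by (simp add: image_image rows_swap_def)
  also have "\<dots> = {1..k}"
    unfolding assms(3) using \<open>k \<le> q\<close> by simp
  finally show False using assms(2) unfolding is_initial_def by blast
qed

lemma column_current: "column current c = (if is_initial (rothe_column w c) then {} else rothe_column w c)"
  unfolding current_def by (rule column_initial_diagram[OF column_rothe_diagram_subset])

lemma final_columns_iff:
  "c \<in> final_columns \<longleftrightarrow> \<not> is_initial (rothe_column w c) \<and> rows_swap ` rothe_column w c = {1..Suc q}"
  by (simp add: final_columns_def column_row_image column_current)

lemma final_columns_subset: "final_columns \<subseteq> {1..n} - block_values"
proof
  fix c assume c: "c \<in> final_columns"
  then have "\<not> is_initial (rothe_column w c)" by (simp add: final_columns_iff)
  moreover from this have "c \<in> {1..n}"
    using column_rothe_diagram_outside[of c n w] by (cases "c \<in> {1..n}") auto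
  ultimately show "c \<in> {1..n} - block_values"
    using left[of c] by (auto simp: block_values_def)
qed

text \<open>No column outside the block has its height in the block: columns from \<open>j\<close> on avoid the rows of
  the block, and a column before \<open>j\<close> belongs to a position below row \<open>q + m + 1\<close> and contains that
  row.\<close>

lemma swap_x_fixed_factor:
  assumes "i \<in> {Suc q..q + m}"
  shows "swap_x i fixed_factor = fixed_factor"
  unfolding fixed_factor_def swap_x_prod
proof (rule prod.cong[OF refl])
  fix c assume c: "c \<in> {1..n} - block_values"
  have "rothe_column w c \<noteq> {1..i}"
  proof (cases "j \<le> c")
    case True
    then show ?thesis using column_right_initial[of c i] assms by auto
  next
    case False
    from c obtain p where p: "p \<in> {1..n}" "w p = c" using obtain_position[OF w, of c] by blast
    have "p \<notin> {Suc q..q + m}" using c p image_block by auto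
    moreover have "\<not> p \<le> q" using above[of p] p False by auto
    moreover have "p \<noteq> Suc (q + m)" using tooth p False by auto
    ultimately have "Suc (q + m) < p" by simp
    then have "Suc (q + m) \<in> rothe_column w c"
      using mem_rothe_column[OF w p(1)] p(2) tooth False by auto
    then show ?thesis using assms by auto
  qed
  then show "swap_x i (initial_factor (rothe_column w c) c) = initial_factor (rothe_column w c) c"
    using assms by (intro swap_x_initial_factor) auto
qed

end

text \<open>A permutation that carries the large value \<open>w (q + m + 1)\<close> in front of the block values, in
  whatever order these come. All such permutations have the same current diagram, and it is the
  one that the orthodontic sequence of \<open>w\<close> reaches after \<open>m\<close> steps. Two of them will be used: one
  that keeps the order of the block, and one that sorts it.\<close>

locale block_moved = tooth_block +
  fixes u :: "nat \<Rightarrow> nat"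
  assumes u: "u permutes {1..n}"
    and u_first: "u (Suc q) = w (Suc (q + m))"
    and u_block: "\<And>r. r \<in> {Suc (Suc q)..Suc (q + m)} \<Longrightarrow> u r \<in> block_values"
    and u_other: "\<And>r. r \<notin> {Suc q..Suc (q + m)} \<Longrightarrow> u r = w r"
    and u_initial: "\<And>c. c \<in> block_values \<Longrightarrow> is_initial (rothe_column u c)"
begin

lemma column_left:
  assumes "c < j" "c \<notin> block_values"
  shows "rothe_column u c = rothe_column w c"
proof (cases "c \<in> {1..n}")
  case True
  then obtain p where p: "p \<in> {1..n}" "w p = c" by (rule obtain_position[OF w])
  have "p \<notin> {Suc q..q + m}" using assms p image_block by auto
  moreover have "\<not> p \<le> q" using above[of p] p assms by auto
  moreover have "p \<noteq> Suc (q + m)" using tooth p assms by auto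
  ultimately have p_gt: "Suc (q + m) < p" by simp
  then have up: "u p = c" using u_other p by auto
  have wx: "c < w x" if "x \<in> {Suc q..Suc (q + m)}" for x
    using value_below_block[OF p(1) p_gt, of x] p assms that by auto
  have ux: "c < u x" if "x \<in> {Suc q..Suc (q + m)}" for x
  proof (cases "x = Suc q")
    case True
    then show ?thesis using tooth u_first assms by simp
  next
    case False
    then have "u x \<in> block_values" using u_block that by simp
    then obtain r where "r \<in> {Suc q..q + m}" "w r = u x" by (rule obtain_block_position)
    then show ?thesis using wx[of r] by simp
  qed
  show ?thesis
  proof (rule set_eqI)
    fix x
    have "c < u x \<longleftrightarrow> c < w x"
      using ux[of x] wx[of x] u_other[of x] by (cases "x \<in> {Suc q..Suc (q + m)}") auto
    then show "x \<in> rothe_column u c \<longleftrightarrow> x \<in> rothe_column w c"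
      using mem_rothe_column[OF u p(1), of x] mem_rothe_column[OF w p(1), of x]
      unfolding up p(2) by simp
  qed
qed (simp add: column_rothe_diagram_outside)

lemma column_right:
  assumes "j \<le> c"
  shows "rothe_column u c = rows_swap ` rothe_column w c"
proof (cases "c \<in> {1..n}")
  case True
  then obtain p where p: "p \<in> {1..n}" "w p = c" by (rule obtain_position[OF w])
  have p_out: "p \<notin> {Suc q..q + m}" using block[of p] assms p by auto
  have mem: "x \<in> rothe_column w c \<longleftrightarrow> 1 \<le> x \<and> x < p \<and> c < w x" for x
    using mem_rothe_column[OF w p(1), of x] p(2) by simp
  have wx: "\<not> c < w x" if "x \<in> {Suc q..q + m}" for x
    using block[OF that] assms by simp
  have ux: "\<not> c < u x" if "x \<in> {Suc (Suc q)..Suc (q + m)}" for x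
    using u_block[OF that] assms by (auto simp: block_values_def)
  have "x \<in> rothe_column u c \<longleftrightarrow> rows_swap x \<in> rothe_column w c" for x
  proof (cases "p = Suc (q + m)")
    case True
    then have "u (Suc q) = c" using u_first p by simp
    then have memu: "x \<in> rothe_column u c \<longleftrightarrow> 1 \<le> x \<and> x < Suc q \<and> c < u x" for x
      using mem_rothe_column[OF u, of "Suc q" x] tooth_le by simp
    consider "x \<le> q" | "x = Suc q" | "x = Suc (q + m)" "m \<noteq> 0" | "x \<in> {Suc (Suc q)..q + m}" | "Suc (q + m) < x"
      using m by (cases "x \<le> Suc q"; cases "x \<le> q + m"; cases "x = Suc q"; cases "x = Suc (q + m)") auto
    then show ?thesis
      by cases (use wx[of "Suc q"] wx[of x] u_other[of x] True in \<open>auto simp: memu mem\<close>)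
  next
    case False
    then have "p \<le> q \<or> Suc (q + m) < p" using p_out by auto
    moreover from this have "u p = c" using u_other[of p] p by auto
    then have memu: "x \<in> rothe_column u c \<longleftrightarrow> 1 \<le> x \<and> x < p \<and> c < u x" for x
      using mem_rothe_column[OF u p(1), of x] by simp
    consider "x \<le> q" | "x = Suc q" | "x = Suc (q + m)" "m \<noteq> 0" | "x \<in> {Suc (Suc q)..q + m}" | "Suc (q + m) < x"
      using m by (cases "x \<le> Suc q"; cases "x \<le> q + m"; cases "x = Suc q"; cases "x = Suc (q + m)") auto
    then show ?thesis
      by cases (use wx[of "Suc q"] wx[of x] ux[of x] u_other[of x] u_first m \<open>p \<le> q \<or> _\<close>
        in \<open>auto simp: memu mem\<close>)
  qed
  then show ?thesis unfolding set_eq_iff mem_image_rows_swap by blast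
qed (simp add: column_rothe_diagram_outside)

lemma initial_diagram_moved:
  "initial_diagram n (rothe_diagram n u) = remove_columns final_columns (row_image rows_swap current)"
proof (rule diagram_eqI)
  fix c
  let ?C = "rothe_column w c"
  have lhs: "column (initial_diagram n (rothe_diagram n u)) c =
      (if is_initial (rothe_column u c) then {} else rothe_column u c)"
    by (rule column_initial_diagram[OF column_rothe_diagram_subset])
  have rhs: "column (remove_columns final_columns (row_image rows_swap current)) c =
      (if c \<in> final_columns then {} else rows_swap ` (if is_initial ?C then {} else ?C))"
    by (simp add: column_remove_columns column_row_image column_current)
  consider "c \<in> block_values" | "c < j" "c \<notin> block_values" | "j \<le> c" by linarith
  then show "column (initial_diagram n (rothe_diagram n u)) c =
      column (remove_columns final_columns (row_image rows_swap current)) c"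
  proof cases
    case 1
    then have "is_initial ?C" using left by (simp add: block_values_def)
    then show ?thesis unfolding lhs rhs using u_initial[OF 1] by simp
  next
    case 2
    then show ?thesis unfolding lhs rhs column_left[OF 2] using left by simp
  next
    case 3
    show ?thesis
    proof (cases "is_initial ?C")
      case True
      then show ?thesis
        unfolding lhs rhs column_right[OF 3] column_right_swap_initial[OF 3 True] by simp
    next
      case False
      then have "is_initial (rows_swap ` ?C) \<longleftrightarrow> c \<in> final_columns"
        unfolding final_columns_iff is_initial_def[of "rows_swap ` ?C"]
        using column_right_swap_not_initial[OF 3 False] by blast
      with False show ?thesis unfolding lhs rhs column_right[OF 3] by simp
    qed
  qed
qed

lemma initial_product_moved:
  "initial_product n (rothe_diagram n u) =
    (\<Prod>c\<in>block_values. initial_factor (rothe_column u c) c) *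
      (fixed_factor * omega_bar (Suc q) final_columns)"
proof -
  have "initial_factor (rothe_column u c) c = initial_factor (rothe_column w c) c *
      (if c \<in> final_columns then column_factor (Suc q) c else 1)"
    if "c \<in> {1..n} - block_values" for c
  proof (cases "j \<le> c")
    case False
    then show ?thesis
      using column_left[of c] left[of c] that by (simp add: final_columns_iff)
  next
    case True
    show ?thesis
    proof (cases "is_initial (rothe_column w c)")
      case init: True
      then show ?thesis
        using column_right[OF True] column_right_swap_initial[OF True init]
        by (simp add: final_columns_iff)
    next
      case init: False
      show ?thesis
      proof (cases "c \<in> final_columns")
        case fin: True
        then have "rothe_column u c = {1..Suc q}"
          using column_right[OF True] by (simp add: final_columns_iff)
        then show ?thesis
          using fin init by (simp add: initial_factor_atLeastAtMost initial_factor_def[of "rothe_column w c"])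
      next
        case fin: False
        have "\<not> is_initial (rothe_column u c)"
        proof
          assume "is_initial (rothe_column u c)"
          then obtain k where k: "rows_swap ` rothe_column w c = {1..k}"
            unfolding column_right[OF True] is_initial_def by (rule exE)
          with column_right_swap_not_initial[OF True init k] init fin show False
            unfolding final_columns_iff by metis
        qed
        then show ?thesis using fin init by (simp add: initial_factor_def)
      qed
    qed
  qed
  then have "(\<Prod>c\<in>{1..n} - block_values. initial_factor (rothe_column u c) c) =
      fixed_factor * (\<Prod>c\<in>{1..n} - block_values.
        if c \<in> final_columns then column_factor (Suc q) c else 1)"
    unfolding fixed_factor_def prod.distrib[symmetric] by (intro prod.cong) auto
  also have "(\<Prod>c\<in>{1..n} - block_values. if c \<in> final_columns then column_factor (Suc q) c else 1) =
      omega_bar (Suc q) final_columns"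
    unfolding omega_bar_eq using final_columns_subset
    by (subst prod.inter_restrict[symmetric]) (simp_all add: Int_absorb1)
  finally show ?thesis
    unfolding initial_product_def
    using prod.subset_diff[OF block_values_subset, of "\<lambda>c. initial_factor (rothe_column u c) c"]
    by (simp add: mult_ac)
qed

end


section \<open>The inductive step\<close>

context tooth_block
begin

lemma gap_current: "r \<in> {Suc q..q + m} \<Longrightarrow> r \<notin> column current c"
  using column_right_gap[of c r] left[of c] by (cases "j \<le> c") (auto simp: column_current)

lemma column_j: "{1..q} \<subseteq> rothe_column w j" "Suc (q + m) \<in> rothe_column w j"
proof -
  obtain p where p: "p \<in> {1..n}" "w p = j" by (rule obtain_position[OF w j])
  have "p \<notin> {Suc q..q + m}" using block[of p] p by auto
  moreover have "\<not> p \<le> q" using above[of p] p by auto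
  moreover have "p \<noteq> Suc (q + m)" using tooth p by auto
  ultimately have "Suc (q + m) < p" by simp
  moreover have "x \<in> rothe_column w j \<longleftrightarrow> 1 \<le> x \<and> x < p \<and> j < w x" for x
    using mem_rothe_column[OF w p(1), of x] p(2) by simp
  ultimately show "{1..q} \<subseteq> rothe_column w j" "Suc (q + m) \<in> rothe_column w j"
    using above tooth by auto
qed

lemma column_current_j: "column current j = rothe_column w j"
proof -
  have "\<not> is_initial (rothe_column w j)"
  proof
    assume "is_initial (rothe_column w j)"
    then obtain k where k: "rothe_column w j = {1..k}" unfolding is_initial_def by (rule exE)
    from column_right_initial[OF _ k] column_j(2) show False unfolding k by simp
  qed
  then show ?thesis by (simp add: column_current)
qed

lemma ortho_value_current:
  assumes "ortho_value n (remove_columns final_columns (row_image rows_swap current)) f"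
  shows "ortho_value n current (pibars q m j (omega_bar (Suc q) final_columns * f))"
proof (rule ortho_value_gap[OF tooth_le m _ _ _ gap_current _ _ assms])
  show "column current c = {}" if "c < j" for c
    using left[OF that] by (simp add: column_current)
qed (simp_all only: column_current_j column_j rows_swap_def final_columns_def)

text \<open>Row \<open>q + m + 1\<close> moves up to row \<open>q + 1\<close>, which was empty.\<close>

lemma row_sum_decreases:
  "row_sum (remove_columns final_columns (row_image rows_swap current)) < row_sum current"
proof -
  have "current \<subseteq> {1..n} \<times> {1..n}"
    unfolding current_def initial_diagram_def using rothe_diagram_subset[of n w]
    by (auto simp: remove_columns_def)
  then have fin: "finite current" by (rule finite_subset) simp
  then have fin': "finite (row_image rows_swap current)" by (simp add: row_image_def)
  have "remove_columns final_columns (row_image rows_swap current) \<subseteq> row_image rows_swap current"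
    by (auto simp: remove_columns_def)
  then have "row_sum (remove_columns final_columns (row_image rows_swap current)) \<le>
      row_sum (row_image rows_swap current)"
    unfolding row_sum_def by (intro sum_mono2 fin') auto
  also have "\<dots> = (\<Sum>(r, c)\<in>current. rows_swap r)"
  proof -
    have "inj_on (\<lambda>(r, c). (rows_swap r, c)) current"
      by (rule inj_on_inverseI[of _ "\<lambda>(r, c). (rows_swap r, c)"]) (auto simp: rows_swap_def)
    then show ?thesis
      unfolding row_sum_def row_image_def by (subst sum.reindex) (simp_all add: case_prod_beta)
  qed
  also have "\<dots> < row_sum current"
    unfolding row_sum_def
  proof (rule sum_strict_mono_ex1[OF fin])
    have "rows_swap r \<le> r" if "(r, c) \<in> current" for r c
    proof -
      have "r \<noteq> Suc q" using gap_current[of "Suc q" c] m that by (auto simp: column_def)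
      then show ?thesis by (cases "r = Suc (q + m)") simp_all
    qed
    then show "\<forall>x\<in>current. (case x of (r, c) \<Rightarrow> rows_swap r) \<le> (case x of (r, c) \<Rightarrow> r)"
      by auto
    have "(Suc (q + m), j) \<in> current"
      using column_j(2) unfolding column_current_j[symmetric] by (simp add: column_def)
    moreover have "rows_swap (Suc (q + m)) < Suc (q + m)" using m by simp
    ultimately show "\<exists>x\<in>current. (case x of (r, c) \<Rightarrow> rows_swap r) < (case x of (r, c) \<Rightarrow> r)"
      by (intro bexI[of _ "(Suc (q + m), j)"]) simp_all
  qed
  finally show ?thesis .
qed

lemma shifted_permutes: "w \<circ> block_shift q m permutes {1..n}"
  by (rule permutes_compose[OF block_shift_permutes[OF tooth_le] w])

lemma shifted_block_iff:
  "(w \<circ> block_shift q m) r \<in> block_values \<longleftrightarrow> r \<in> {Suc (Suc q)..Suc (q + m)}"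
proof -
  have "(w \<circ> block_shift q m) r \<in> block_values \<longleftrightarrow> block_shift q m r \<in> {Suc q..q + m}"
    unfolding image_block[symmetric] by (simp add: inj_image_mem_iff[OF permutes_inj[OF w]])
  also have "\<dots> \<longleftrightarrow> r \<in> {Suc (Suc q)..Suc (q + m)}"
    by (auto simp: block_shift_def)
  finally show ?thesis .
qed

text \<open>Each column of the block gains one box, since the large value is now in front of it.\<close>

lemma shifted_column:
  assumes "c \<in> block_values"
  shows "rothe_column (w \<circ> block_shift q m) c = {1..Suc (col_height c)}"
proof (rule set_eqI)
  fix x
  let ?u = "w \<circ> block_shift q m"
  obtain r where r: "r \<in> {Suc q..q + m}" "w r = c" by (rule obtain_block_position[OF assms])
  note kb = col_height_bounds[OF assms r]
  have cj: "c < j" using assms by (simp add: block_values_def)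
  have ur: "?u (Suc r) = c" using r by (simp add: block_shift_def)
  have mem: "x \<in> rothe_column ?u c \<longleftrightarrow> 1 \<le> x \<and> x < Suc r \<and> c < ?u x"
    using mem_rothe_column[OF shifted_permutes, of "Suc r" x] r tooth_le unfolding ur by simp
  consider "x = 0" | "1 \<le> x" "x \<le> q" | "x = Suc q" | "Suc q < x" "x \<le> r" | "r < x"
    by linarith
  then show "x \<in> rothe_column ?u c \<longleftrightarrow> x \<in> {1..Suc (col_height c)}"
  proof cases
    case 2
    then have "c < ?u x" using above[of x] cj by (simp add: block_shift_def)
    then show ?thesis unfolding mem using 2 r kb by simp
  next
    case 3
    then have "c < ?u x" using tooth cj by (simp add: block_shift_def)
    then show ?thesis unfolding mem using 3 r kb by simp
  next
    case 4
    then have "?u x = w (x - 1)" using r by (simp add: block_shift_def)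
    moreover have "x - 1 \<le> col_height c \<longleftrightarrow> x - 1 < r \<and> c < w (x - 1)"
      using 4 by (intro block_column_iff[OF assms r]) simp
    ultimately show ?thesis unfolding mem using 4 by auto
  qed (use kb mem in auto)
qed

sublocale shifted: block_moved n w j q m "w \<circ> block_shift q m"
proof
  show "is_initial (rothe_column (w \<circ> block_shift q m) c)" if "c \<in> block_values" for c
    unfolding shifted_column[OF that] is_initial_def by blast
  show "(w \<circ> block_shift q m) r \<in> block_values" if "r \<in> {Suc (Suc q)..Suc (q + m)}" for r
    using that unfolding shifted_block_iff .
  show "(w \<circ> block_shift q m) r = w r" if "r \<notin> {Suc q..Suc (q + m)}" for r
    using that by (auto simp: block_shift_def)
qed (rule shifted_permutes, simp add: block_shift_def)

text \<open>With its block sorted, the permutation has ascents inside the block; therefore its Grothendieck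
  polynomial is symmetric there.\<close>

definition sorted_perm :: "nat \<Rightarrow> nat" where
  "sorted_perm r = (if r \<in> {Suc (Suc q)..Suc (q + m)} then j - m + (r - Suc (Suc q))
    else (w \<circ> block_shift q m) r)"

lemma sorted_perm_block:
  assumes "r \<in> {Suc (Suc q)..Suc (q + m)}"
  shows "sorted_perm r = j - m + (r - Suc (Suc q))" "sorted_perm r \<in> block_values"
  using assms m_le_j by (auto simp: sorted_perm_def block_values_def)

lemma sorted_perm_other:
  "r \<notin> {Suc (Suc q)..Suc (q + m)} \<Longrightarrow> sorted_perm r = (w \<circ> block_shift q m) r"
  unfolding sorted_perm_def by (rule if_not_P)

lemma sorted_perm_permutes: "sorted_perm permutes {1..n}"
proof (rule bij_imp_permutes)
  let ?B = "{Suc (Suc q)..Suc (q + m)}"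
  let ?u = "w \<circ> block_shift q m"
  have "inj_on sorted_perm {1..n}"
  proof (rule inj_onI)
    fix a b assume eq: "sorted_perm a = sorted_perm b"
    have iff: "sorted_perm r \<in> block_values \<longleftrightarrow> r \<in> ?B" for r
      using sorted_perm_block(2)[of r] sorted_perm_other[of r] shifted_block_iff[of r]
      by (cases "r \<in> ?B") auto
    show "a = b"
    proof (cases "a \<in> ?B")
      case True
      with iff eq have "b \<in> ?B" by metis
      with True eq show ?thesis using sorted_perm_block(1)[of a] sorted_perm_block(1)[of b] by auto
    next
      case False
      with iff eq have "b \<notin> ?B" by metis
      with False eq have "?u a = ?u b" using sorted_perm_other by metis
      then show ?thesis using permutes_inj[OF shifted_permutes] by (metis injD)
    qed
  qed
  moreover have "sorted_perm r \<in> {1..n}" if "r \<in> {1..n}" for r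
  proof (cases "r \<in> ?B")
    case True
    then show ?thesis using sorted_perm_block(2) block_values_subset by blast
  next
    case False
    show ?thesis
      unfolding sorted_perm_other[OF False] permutes_in_image[OF shifted_permutes] by (rule that)
  qed
  then have "sorted_perm ` {1..n} \<subseteq> {1..n}" by (rule image_subsetI)
  ultimately show "bij_betw sorted_perm {1..n} {1..n}"
    unfolding bij_betw_def using endo_inj_surj[of "{1..n}"] by blast
  show "sorted_perm r = r" if "r \<notin> {1..n}" for r
  proof -
    have "r \<notin> ?B" using that tooth_le by auto
    then show ?thesis
      using sorted_perm_other[of r] permutes_not_in[OF shifted_permutes that] by simp
  qed
qed

lemma sorted_column:
  assumes "c \<in> block_values"
  shows "rothe_column sorted_perm c = {1..Suc q}"
proof (rule set_eqI)
  fix x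
  let ?B = "{Suc (Suc q)..Suc (q + m)}"
  define p where "p = Suc (Suc q) + (c - (j - m))"
  have c: "j - m \<le> c" "c < j" using assms by (simp_all add: block_values_def)
  have p: "p \<in> ?B" using c m_le_j by (auto simp: p_def)
  then have up: "sorted_perm p = c" using c sorted_perm_block(1)[OF p] by (simp add: p_def)
  have mem: "x \<in> rothe_column sorted_perm c \<longleftrightarrow> 1 \<le> x \<and> x < p \<and> c < sorted_perm x"
    using mem_rothe_column[OF sorted_perm_permutes, of p x] p tooth_le unfolding up by simp
  consider "x = 0" | "1 \<le> x" "x \<le> q" | "x = Suc q" | "Suc q < x" "x < p" | "p \<le> x"
    by linarith
  then show "x \<in> rothe_column sorted_perm c \<longleftrightarrow> x \<in> {1..Suc q}"
  proof cases
    case 2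
    then have "sorted_perm x = w x" using sorted_perm_other[of x] by (simp add: block_shift_def)
    then have "c < sorted_perm x" using above[of x] 2 c by simp
    then show ?thesis unfolding mem using 2 p by simp
  next
    case 3
    then have "c < sorted_perm x"
      using sorted_perm_other[of x] tooth c by (simp add: block_shift_def)
    then show ?thesis unfolding mem using 3 p by simp
  next
    case 4
    then have "sorted_perm x = j - m + (x - Suc (Suc q))"
      using p by (intro sorted_perm_block(1)) simp
    then have "\<not> c < sorted_perm x" using 4 c by (simp add: p_def)
    then show ?thesis unfolding mem using 4 by simp
  qed (use mem p in auto)
qed

sublocale sorted: block_moved n w j q m sorted_perm
proof
  show "is_initial (rothe_column sorted_perm c)" if "c \<in> block_values" for c
    unfolding sorted_column[OF that] is_initial_def by blast
  show "sorted_perm (Suc q) = w (Suc (q + m))"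
    using sorted_perm_other[of "Suc q"] by (simp add: block_shift_def)
  show "sorted_perm r = w r" if "r \<notin> {Suc q..Suc (q + m)}" for r
    using sorted_perm_other[of r] shifted.u_other[OF that] that by auto
qed (rule sorted_perm_permutes, rule sorted_perm_block)

lemma swap_x_sorted:
  assumes "i \<in> {Suc (Suc q)..q + m}"
  shows "swap_x i (double_grothendieck n sorted_perm) = double_grothendieck n sorted_perm"
proof -
  have "i \<in> {Suc (Suc q)..Suc (q + m)}" "Suc i \<in> {Suc (Suc q)..Suc (q + m)}"
    using assms by auto
  note sorted_perm_block(1)[OF this(1)] sorted_perm_block(1)[OF this(2)]
  moreover have "i - Suc (Suc q) < Suc i - Suc (Suc q)" using assms by auto
  ultimately have "sorted_perm i < sorted_perm (Suc i)" by linarith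
  then have "double_grothendieck n sorted_perm =
      ddiff_bar i (double_grothendieck n (sorted_perm \<circ> simple_refl i))"
    using assms tooth_le by (intro double_grothendieck_ascent sorted_perm_permutes) auto
  then show ?thesis by (metis swap_x_ddiff_bar)
qed

text \<open>By induction, the Grothendieck polynomials of the shifted and of the sorted permutation are
  their initial products times the same polynomial \<open>f\<close>, as the current diagrams agree. For the sorted
  one, both the Grothendieck polynomial and the initial product are symmetric in
  \<open>x\<^sub>q\<^sub>+\<^sub>2, \<dots>, x\<^sub>q\<^sub>+\<^sub>m\<^sub>+\<^sub>1\<close>; hence so is \<open>f\<close>. This is the hypothesis needed to
  apply \<open>dbars_column_factors\<close> to the shifted permutation, which leads to \<open>w\<close> by \<open>dbars q m\<close>.\<close>

lemma ortho_value_step: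
  assumes IH: "\<And>u. u permutes {1..n} \<Longrightarrow>
      row_sum (initial_diagram n (rothe_diagram n u)) < row_sum current \<Longrightarrow>
      \<exists>f. ortho_value n (initial_diagram n (rothe_diagram n u)) f \<and>
        double_grothendieck n u = initial_product n (rothe_diagram n u) * f"
  shows "\<exists>f. ortho_value n current f \<and>
    double_grothendieck n w = initial_product n (rothe_diagram n w) * f"
proof -
  let ?u = "w \<circ> block_shift q m"
  let ?\<omega> = "omega_bar (Suc q) final_columns"
  let ?P = "\<lambda>h. \<Prod>c\<in>block_values. column_factor (h c) c"
  obtain f where f: "ortho_value n (initial_diagram n (rothe_diagram n ?u)) f"
    "double_grothendieck n ?u = initial_product n (rothe_diagram n ?u) * f"
    using IH[OF shifted_permutes] row_sum_decreases unfolding shifted.initial_diagram_moved by blast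
  obtain g where g: "ortho_value n (initial_diagram n (rothe_diagram n sorted_perm)) g"
    "double_grothendieck n sorted_perm = initial_product n (rothe_diagram n sorted_perm) * g"
    using IH[OF sorted_perm_permutes] row_sum_decreases unfolding sorted.initial_diagram_moved by blast
  have "g = f"
    using f(1) g(1) unfolding shifted.initial_diagram_moved sorted.initial_diagram_moved
    by (metis ortho_value_unique)
  have col_P: "(\<Prod>c\<in>block_values. initial_factor (rothe_column v c) c) = ?P h"
    if "\<And>c. c \<in> block_values \<Longrightarrow> rothe_column v c = {1..h c}" for v h
    using that by (intro prod.cong) (simp_all add: initial_factor_atLeastAtMost)
  have omega_sym: "swap_x i ?\<omega> = ?\<omega>" if "i \<in> {Suc (Suc q)..q + m}" for i
    unfolding omega_bar_eq swap_x_prod using that by (intro prod.cong swap_x_column_factor) auto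
  have f_sym: "swap_x i f = f" if i: "i \<in> {Suc (Suc q)..q + m}" for i
  proof -
    let ?I = "initial_product n (rothe_diagram n sorted_perm)"
    have I: "?I = ?P (\<lambda>_. Suc q) * (fixed_factor * ?\<omega>)"
      unfolding sorted.initial_product_moved using col_P[OF sorted_column] by simp
    have "swap_x i (?P (\<lambda>_. Suc q)) = ?P (\<lambda>_. Suc q)"
      unfolding swap_x_prod using i by (intro prod.cong swap_x_column_factor) auto
    then have "swap_x i ?I = ?I"
      unfolding I using i by (simp add: swap_x_hom omega_sym swap_x_fixed_factor)
    moreover have "swap_x i (?I * f) = ?I * f"
      using swap_x_sorted[OF i] g(2) \<open>g = f\<close> by simp
    ultimately have "?I * swap_x i f = ?I * f" by (simp add: swap_x_mult)
    then show ?thesis using initial_product_nonzero by (metis mult_left_cancel)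
  qed
  have "double_grothendieck n w = dbars q m (double_grothendieck n ?u)"
    using block tooth
    by (intro double_grothendieck_block_shift[OF w tooth_le]) (meson less_trans)
  also have "double_grothendieck n ?u =
      fixed_factor * (?P (\<lambda>c. Suc (col_height c)) * (?\<omega> * f))"
    unfolding f(2) shifted.initial_product_moved using col_P[OF shifted_column]
    by (simp add: mult_ac)
  also have "dbars q m \<dots> = fixed_factor * dbars q m (?P (\<lambda>c. Suc (col_height c)) * (?\<omega> * f))"
    using swap_x_fixed_factor by (intro dbars_mult_sym) simp
  also have "dbars q m (?P (\<lambda>c. Suc (col_height c)) * (?\<omega> * f)) =
      ?P col_height * pibars q m j (?\<omega> * f)"
    unfolding block_values_def
  proof (rule dbars_column_factors[OF m_le_j col_height_less])
    show "col_height d \<le> col_height c" if "j - m \<le> c" "c \<le> d" "d < j" for c d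
      using that by (intro col_height_antitone) (auto simp: block_values_def)
    show "swap_x i (?\<omega> * f) = ?\<omega> * f" if "i \<in> {q + 2..q + m}" for i
      using that by (simp add: swap_x_mult omega_sym f_sym)
  qed
  finally have "double_grothendieck n w =
      (?P col_height * fixed_factor) * pibars q m j (?\<omega> * f)"
    by (simp add: mult_ac)
  also have "?P col_height * fixed_factor = initial_product n (rothe_diagram n w)"
    unfolding initial_product_def fixed_factor_def
    using prod.subset_diff[OF block_values_subset, of "\<lambda>c. initial_factor (rothe_column w c) c"]
      col_P[OF block_column] by (simp add: mult.commute)
  finally show ?thesis
    using ortho_value_current f(1) unfolding shifted.initial_diagram_moved by blast
qed

end

text \<open>Take the leftmost column \<open>j\<close> that is not initial, its first missing row \<open>t\<close>, and the next row
  \<open>s\<close> that it contains.\<close>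

lemma obtain_tooth_block:
  assumes w: "w permutes {1..n}" and "initial_diagram n (rothe_diagram n w) \<noteq> {}"
  obtains j q m where "tooth_block n w j q m"
proof -
  let ?C = "column (rothe_diagram n w)"
  have "\<exists>c. \<not> is_initial (?C c)"
  proof (rule ccontr)
    assume "\<nexists>c. \<not> is_initial (?C c)"
    then have "column (initial_diagram n (rothe_diagram n w)) c = column {} c" for c
      unfolding column_initial_diagram[OF column_rothe_diagram_subset] by (simp add: column_def)
    then show False using diagram_eqI assms(2) by blast
  qed
  define j where "j = (LEAST c. \<not> is_initial (?C c))"
  have not_init: "\<not> is_initial (?C j)"
    unfolding j_def using \<open>\<exists>c. _\<close> by (rule LeastI_ex)
  have left: "is_initial (?C c)" if "c < j" for c
    using not_less_Least that unfolding j_def by blast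
  have j: "j \<in> {1..n}"
    using column_rothe_diagram_outside[of j n w] not_init by (cases "j \<in> {1..n}") auto
  obtain p where p: "p \<in> {1..n}" "w p = j" by (rule obtain_position[OF w j])
  have mem: "x \<in> ?C j \<longleftrightarrow> 1 \<le> x \<and> x < p \<and> j < w x" for x
    using column_rothe_diagram[OF w p(1)] p(2) by simp
  define t where "t = (LEAST x. 1 \<le> x \<and> x \<notin> ?C j)"
  have "1 \<le> p \<and> p \<notin> ?C j" using p(1) by (simp add: mem)
  then have "1 \<le> t \<and> t \<notin> ?C j" unfolding t_def by (rule LeastI)
  then have t: "1 \<le> t" "t \<notin> ?C j" by blast+
  have below: "x \<in> ?C j" if "1 \<le> x" "x < t" for x
    using not_less_Least[of x "\<lambda>x. 1 \<le> x \<and> x \<notin> ?C j"] that unfolding t_def by blast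
  have "\<exists>x. t < x \<and> x \<in> ?C j"
  proof (rule ccontr)
    assume none: "\<nexists>x. t < x \<and> x \<in> ?C j"
    have "?C j = {1..t - 1}"
    proof (intro equalityI subsetI)
      fix x assume x: "x \<in> ?C j"
      then have "x \<noteq> t" "\<not> t < x" "1 \<le> x" using t none mem by auto
      then show "x \<in> {1..t - 1}" by simp
    qed (use below in auto)
    then show False using not_init unfolding is_initial_def by blast
  qed
  define s where "s = (LEAST x. t < x \<and> x \<in> ?C j)"
  have s: "t < s" "s \<in> ?C j"
    using LeastI_ex[OF \<open>\<exists>x. t < x \<and> x \<in> ?C j\<close>] unfolding s_def by blast+
  have between: "x \<notin> ?C j" if "t < x" "x < s" for x
    using not_less_Least[of x "\<lambda>x. t < x \<and> x \<in> ?C j"] that unfolding s_def by blast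
  define q m where "q = t - 1" and "m = s - t"
  have eqs: "Suc q = t" "Suc (q + m) = s" "1 \<le> m"
    using t(1) s(1) by (simp_all add: q_def m_def)
  have "tooth_block n w j q m"
  proof
    show "Suc (q + m) \<le> n" using s(2) p(1) unfolding eqs mem by simp
    show "j < w r" if "r \<in> {1..q}" for r
      using below[of r] that eqs unfolding mem by simp
    show "j < w (Suc (q + m))" using s(2) unfolding eqs mem by simp
    show "w r < j" if r: "r \<in> {Suc q..q + m}" for r
    proof -
      have "r \<notin> ?C j" using between[of r] t(2) r eqs by (cases "r = t") auto
      moreover have "1 \<le> r" "r < p" using r eqs s(2) unfolding mem by auto
      ultimately have "w r \<le> j" "r \<noteq> p" unfolding mem by auto
      moreover have "w r \<noteq> w p"
        using \<open>r \<noteq> p\<close> permutes_inj[OF w] by (metis injD)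
      ultimately show ?thesis using p(2) by simp
    qed
  qed (use w eqs j left in auto)
  then show ?thesis by (rule that)
qed

text \<open>Induction on the row sum of the current diagram rather than on the length of \<open>w\<close>: sorting the
  block may make the permutation shorter than \<open>w\<close>, but it leaves the current diagram unchanged.\<close>

lemma ortho_value_rothe_diagram:
  assumes "w permutes {1..n}"
  shows "\<exists>f. ortho_value n (initial_diagram n (rothe_diagram n w)) f \<and>
    double_grothendieck n w = initial_product n (rothe_diagram n w) * f"
  using assms
proof (induction "row_sum (initial_diagram n (rothe_diagram n w))" arbitrary: w rule: less_induct)
  case less
  show ?case
  proof (cases "initial_diagram n (rothe_diagram n w) = {}")
    case True
    have "is_initial (column (rothe_diagram n w) c)" for c
      using column_initial_diagram[OF column_rothe_diagram_subset[of n w c]]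
      unfolding True by (auto simp: column_def split: if_splits)
    then have "double_grothendieck n w = initial_product n (rothe_diagram n w) * 1"
      using double_grothendieck_dominant[OF less.prems] by simp
    then show ?thesis unfolding True using ortho_value.empty by blast
  next
    case False
    then obtain j q m where "tooth_block n w j q m"
      by (rule obtain_tooth_block[OF less.prems])
    then interpret tooth_block n w j q m .
    show ?thesis
      using ortho_value_step less.hyps unfolding current_def by blast
  qed
qed

theorem theorem1p1:
  fixes n :: nat and w :: "nat \<Rightarrow> nat"
  assumes "w permutes {1..n}"
  shows "ortho_polynomial n (rothe_diagram n w) = double_grothendieck n w"
  using ortho_value_rothe_diagram[OF assms] ortho_polynomial_eq[OF rothe_diagram_subset] by metis

end
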